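(* The uniform line sum optimization problem can be solved in polynomial time. That is, there is an algorithm which, given positive integers $m,n$ and functions $f:\{0,1,\dots,n\}\to\mathbb{Z}$ and $g:\{0,1,\dots,m\}\to\mathbb{Z}$, computes in polynomial time a matrix $A\in\{0,1\}^{m\times n}$ which minimizes $$\sum_{i=1}^m f(r_i(A))+\sum_{j=1}^n g(c_j(A))$$ over all matrices in $\{0,1\}^{m\times n}$.
   Context: For an $m\times n$ matrix $A$, the row sums are $r_i(A):=\sum_{j=1}^n A_{i,j}$ for $i\in\{1,\dots,m\}$ and the column sums are $c_j(A):=\sum_{i=1}^m A_{i,j}$ for $j\in\{1,\dots,n\}$. The general line sum optimization problem is: given positive integers $m,n$ and functions $f_i:\{0,1,\dots,n\}\to\mathbb{Z}$ for $i\in\{1,\dots,m\}$ and $g_j:\{0,1,\dots,m\}\to\mathbb{Z}$ for $j\in\{1,\dots,n\}$, find $A\in\{0,1\}^{m\times n}$ minimizing $\sum_{i=1}^m f_i(r_i(A))+\sum_{j=1}^n g_j(c_j(A))$. The uniform problem is the case where all $f_i$ equal one function $f$ and all $g_j$ equal one function $g$. The functions are arbitrary (no convexity or monotonicity is assumed) and are given as part of the input by the lists of their integer values, with integers encoded in binary; polynomial time means that the running time is bounded by a polynomial in the length of the input. *)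

theory Defs
  imports
    "Jordan_Normal_Form.Matrix"
    "HOL-Library.Log_Nat"
    "HOL-Computational_Algebra.Polynomial"
begin

section \<open>Random access machines with logarithmic cost\<close>

text \<open>
  Running time is measured on a random access machine under the logarithmic cost criterion
  (Cook and Reckhow 1973; Aho, Hopcroft and Ullman 1974), which is polynomially equivalent to the
  Turing machine.  The machine has registers X0, X1, X2, ..., each holding an integer and initially
  0, a read-once input tape and a write-once output tape of integers.  The one departure from the
  textbook presentation is that jumps on the sign of a register are organised as conditionals and
  loops.
\<close>

datatype ram =
    Const nat int          \<comment> \<open>\<open>Const i c\<close>: Xi := c\<close>
  | Add nat nat nat        \<comment> \<open>\<open>Add i j k\<close>: Xi := Xj + Xk\<close>
  | Sub nat nat nat        \<comment> \<open>\<open>Sub i j k\<close>: Xi := Xj - Xk\<close>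
  | Mul nat nat nat        \<comment> \<open>\<open>Mul i j k\<close>: Xi := Xj * Xk\<close>
  | Load nat nat           \<comment> \<open>\<open>Load i j\<close>: Xi := the register whose index is stored in Xj\<close>
  | Store nat nat          \<comment> \<open>\<open>Store i j\<close>: the register whose index is stored in Xi := Xj\<close>
  | Read nat               \<comment> \<open>\<open>Read i\<close>: Xi := next integer on the input tape\<close>
  | Write nat              \<comment> \<open>\<open>Write i\<close>: append Xi to the output tape\<close>
  | Skip
  | Seq ram ram
  | IfPos nat ram ram      \<comment> \<open>\<open>IfPos i c d\<close>: if Xi > 0 then c else d\<close>
  | WhilePos nat ram       \<comment> \<open>\<open>WhilePos i c\<close>: while Xi > 0 do c\<close>

text \<open>The number of binary digits of the absolute value, plus one for the sign; so 0 has size 1.\<close>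

definition int_size :: "int \<Rightarrow> nat" where
  "int_size x = floorlog 2 (nat \<bar>x\<bar>) + 1"

type_synonym config = "(nat \<Rightarrow> int) \<times> int list \<times> int list"
  \<comment> \<open>registers, remaining input, output produced so far\<close>

text \<open>
  \<open>exec c s t s'\<close>: started in configuration \<open>s\<close>, program \<open>c\<close> halts in configuration \<open>s'\<close> after
  time \<open>t\<close>.  Every elementary step is charged the sizes of the integers it operates on, including
  the addresses used in indirect accesses.  This includes multiplication, as in Aho, Hopcroft and
  Ullman: a product has at most as many digits as its factors together, so bit costs remain
  polynomially related.  An indirect access to a negative address and
  reading past the end of the input have no rule: the machine then gets stuck and does not halt.
\<close>

inductive exec :: "ram \<Rightarrow> config \<Rightarrow> nat \<Rightarrow> config \<Rightarrow> bool" where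
  Const: "exec (Const i c) (X, xs, ys) (int_size c) (X(i := c), xs, ys)"
| Add: "exec (Add i j k) (X, xs, ys) (int_size (X j) + int_size (X k)) (X(i := X j + X k), xs, ys)"
| Sub: "exec (Sub i j k) (X, xs, ys) (int_size (X j) + int_size (X k)) (X(i := X j - X k), xs, ys)"
| Mul: "exec (Mul i j k) (X, xs, ys) (int_size (X j) + int_size (X k)) (X(i := X j * X k), xs, ys)"
| Load: "X j \<ge> 0 \<Longrightarrow>
    exec (Load i j) (X, xs, ys) (int_size (X j) + int_size (X (nat (X j))))
      (X(i := X (nat (X j))), xs, ys)"
| Store: "X i \<ge> 0 \<Longrightarrow>
    exec (Store i j) (X, xs, ys) (int_size (X i) + int_size (X j))
      (X(nat (X i) := X j), xs, ys)"
| Read: "exec (Read i) (X, x # xs, ys) (int_size x) (X(i := x), xs, ys)"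
| Write: "exec (Write i) (X, xs, ys) (int_size (X i)) (X, xs, ys @ [X i])"
| Skip: "exec Skip s 1 s"
| Seq: "exec c s t s' \<Longrightarrow> exec d s' u s'' \<Longrightarrow> exec (Seq c d) s (t + u) s''"
| IfTrue: "X i > 0 \<Longrightarrow> exec c (X, xs, ys) t s' \<Longrightarrow>
    exec (IfPos i c d) (X, xs, ys) (int_size (X i) + t) s'"
| IfFalse: "\<not> X i > 0 \<Longrightarrow> exec d (X, xs, ys) t s' \<Longrightarrow>
    exec (IfPos i c d) (X, xs, ys) (int_size (X i) + t) s'"
| WhileFalse: "\<not> X i > 0 \<Longrightarrow> exec (WhilePos i c) (X, xs, ys) (int_size (X i)) (X, xs, ys)"
| WhileTrue: "X i > 0 \<Longrightarrow> exec c (X, xs, ys) t s' \<Longrightarrow> exec (WhilePos i c) s' u s'' \<Longrightarrow>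
    exec (WhilePos i c) (X, xs, ys) (int_size (X i) + t + u) s''"

lemma exec_deterministic:
  "exec c s t s' \<Longrightarrow> exec c s u s'' \<Longrightarrow> t = u \<and> s' = s''"
proof (induction arbitrary: u s'' rule: exec.induct)
  case (Seq c s t s' d u' s'')
  from Seq.prems show ?case by cases (use Seq.IH in blast)
next
  case (IfTrue X i c xs ys t s' d)
  from IfTrue.prems show ?case by cases (use IfTrue in blast)+
next
  case (IfFalse X i d xs ys t s' c)
  from IfFalse.prems show ?case by cases (use IfFalse in blast)+
next
  case (WhileTrue X i c xs ys t s' u' s'')
  from WhileTrue.prems show ?case by cases (use WhileTrue in blast)+
next
  case (WhileFalse X i c xs ys)
  from WhileFalse.prems show ?case by cases (use WhileFalse in auto)
qed (erule exec.cases; simp; fail)+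

definition halts_with :: "ram \<Rightarrow> int list \<Rightarrow> int list \<Rightarrow> nat \<Rightarrow> bool" where
  "halts_with P inp out t \<longleftrightarrow> (\<exists>X xs. exec P (\<lambda>_. 0, inp, []) t (X, xs, out))"

definition input_length :: "int list \<Rightarrow> nat" where
  "input_length xs = (\<Sum>x\<leftarrow>xs. int_size x)"


section \<open>Line sum optimization\<close>

text \<open>Rows and columns are indexed from 0, as in the matrix library.\<close>

definition row_sum :: "nat mat \<Rightarrow> nat \<Rightarrow> nat" where
  "row_sum A i = (\<Sum>j<dim_col A. A $$ (i, j))"

definition col_sum :: "nat mat \<Rightarrow> nat \<Rightarrow> nat" where
  "col_sum A j = (\<Sum>i<dim_row A. A $$ (i, j))"

definition binary_mats :: "nat \<Rightarrow> nat \<Rightarrow> nat mat set" where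
  "binary_mats m n = {A \<in> carrier_mat m n. \<forall>i<m. \<forall>j<n. A $$ (i, j) \<in> {0, 1}}"

definition uniform_objective :: "(nat \<Rightarrow> int) \<Rightarrow> (nat \<Rightarrow> int) \<Rightarrow> nat mat \<Rightarrow> int" where
  "uniform_objective f g A =
     (\<Sum>i<dim_row A. f (row_sum A i)) + (\<Sum>j<dim_col A. g (col_sum A j))"

text \<open>
  The functions are total on the naturals for convenience; only the values of \<open>f\<close> on
  \<open>{0..n}\<close> and of \<open>g\<close> on \<open>{0..m}\<close> are part of the input or matter for the objective.
\<close>

definition encode_instance :: "nat \<Rightarrow> nat \<Rightarrow> (nat \<Rightarrow> int) \<Rightarrow> (nat \<Rightarrow> int) \<Rightarrow> int list" where
  "encode_instance m n f g = [int m, int n] @ map f [0..<n + 1] @ map g [0..<m + 1]"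

text \<open>The entries in row-major order.\<close>

definition encode_mat :: "nat mat \<Rightarrow> int list" where
  "encode_mat A = [int (A $$ (i, j)). i \<leftarrow> [0..<dim_row A], j \<leftarrow> [0..<dim_col A]]"

end

theory Submission
  imports Defs
begin

text \<open>
  Nonincreasing row sums \<open>r\<^sub>1 \<ge> \<dots> \<ge> r\<^sub>m\<close> and column sums \<open>c\<close> with conjugate
  \<open>c\<^sup>*\<close> are realised by a 0/1 matrix iff \<open>r\<^sub>1 + \<dots> + r\<^sub>k \<le> c\<^sup>*\<^sub>1 + \<dots> + c\<^sup>*\<^sub>k\<close> for all \<open>k\<close>, with
  equality for \<open>k = m\<close> (Gale-Ryser), and then serving the rows in order, each from the columns
  with the largest remaining sums, produces such a matrix.  The columns with sum \<open>k\<close> number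
  \<open>c\<^sup>*\<^sub>k - c\<^sup>*\<^bsub>k+1\<^esub>\<close>, so the objective is a sum over \<open>k\<close> of terms depending on \<open>r\<^sub>k\<close>, \<open>c\<^sup>*\<^sub>k\<close>,
  \<open>c\<^sup>*\<^bsub>k+1\<^esub>\<close>, and dynamic programming over \<open>k\<close>, \<open>r\<^sub>k\<close>, \<open>c\<^sup>*\<^sub>k\<close> and the slack of the \<open>k\<close>-th
  inequality minimises it.

  For the running time, the program uses only loops of exactly \<open>q = (m + K) (n + K)\<close> rounds, with
  \<open>K\<close> depending on the program alone.  Hence the number of elementary steps is polynomial for
  syntactic reasons; as every step increases the largest integer by a factor of at most \<open>q\<close>, the
  sizes of all integers, and with them the logarithmic cost, are polynomial as well.
\<close>

section \<open>Step counting\<close>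

text \<open>The \<open>k\<close>-th Gale-Ryser inequality involves only the first \<open>k\<close>
  rows and the first \<open>k\<close> levels of the columns, so everything fixed earlier enters the
  later inequalities through one number, the slack. The rows still to come must use it up, so it
  never exceeds \<open>m * n\<close>, and the states are polynomially many although \<open>f\<close>
  and \<open>g\<close> are arbitrary. On the machine side the obstacle is multiplication: squaring a
  value in every step would produce exponentially long integers. One factor of every product is
  therefore kept at most \<open>q\<close>. The same \<open>q\<close> is the number of rounds of each
  loop, the base of the addresses and the upper end of the scratch registers. It is polynomial in
  the input length, although \<open>m\<close> and \<open>n\<close> are written in binary, because
  the instance lists \<open>n + 1\<close> and \<open>m + 1\<close> values, each of size at least
  1.\<close>

lemma int_size_mono: "\<bar>x\<bar> \<le> int v \<Longrightarrow> int_size x \<le> floorlog 2 v + 1"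
  unfolding int_size_def by (simp add: floorlog_mono nat_le_iff)

lemma floorlog_mult_le: "floorlog 2 (a * b) \<le> floorlog 2 a + floorlog 2 b"
proof (rule floorlog_leI)
  show "a * b < 2 ^ (floorlog 2 a + floorlog 2 b)"
    unfolding power_add by (rule mult_strict_mono[OF floorlog_leD floorlog_leD]) auto
qed auto

text \<open>The summand 1 pays for \<open>k = 0\<close>, since
  \<open>floorlog 2 1 = 1\<close>.\<close>

lemma floorlog_power_le: "floorlog 2 (a ^ k) \<le> k * floorlog 2 a + 1"
proof (induction k)
  case (Suc k)
  then show ?case using floorlog_mult_le[of a "a ^ k"] by simp
qed (simp add: floorlog_def)

text \<open>The output tape is left out: it is never read, so it cannot influence later
  values.\<close>

definition bounded_config :: "nat \<Rightarrow> config \<Rightarrow> bool" where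
  "bounded_config V s \<longleftrightarrow>
     (\<forall>r. \<bar>fst s r\<bar> \<le> int V) \<and> (\<forall>x\<in>set (fst (snd s)). \<bar>x\<bar> \<le> int V)"

lemma bounded_config_iff:
  "bounded_config V (X, xs, ys) \<longleftrightarrow> (\<forall>r. \<bar>X r\<bar> \<le> int V) \<and> (\<forall>x\<in>set xs. \<bar>x\<bar> \<le> int V)"
  by (simp add: bounded_config_def)

lemma bounded_config_mono: "bounded_config V s \<Longrightarrow> V \<le> V' \<Longrightarrow> bounded_config V' s"
  unfolding bounded_config_def by (meson of_nat_mono order_trans)

text \<open>Each of \<open>k\<close> steps touches at most two integers, none larger than the bound
  \<open>V * W ^ k\<close> valid at the end.\<close>

definition time_bound :: "nat \<Rightarrow> nat \<Rightarrow> nat \<Rightarrow> nat" where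
  "time_bound W V k = 2 * k * (floorlog 2 (V * W ^ k) + 1)"

text \<open>Every unit step enlarges the values by a factor of at most \<open>W\<close>, so the number \<open>k\<close> of steps
  controls both their sizes and the logarithmic cost.\<close>

definition runs :: "nat \<Rightarrow> ram \<Rightarrow> config \<Rightarrow> nat \<Rightarrow> config \<Rightarrow> bool" where
  "runs W c s k s' \<longleftrightarrow> (\<forall>V\<ge>1. bounded_config V s \<longrightarrow>
     bounded_config (V * W ^ k) s' \<and> (\<exists>t. exec c s t s' \<and> t \<le> time_bound W V k))"

context
  fixes W :: nat
  assumes W: "W \<ge> 2"
begin

lemma growth_mono: "k \<le> l \<Longrightarrow> V * W ^ k \<le> V * W ^ l"
  using W by (simp add: power_increasing)

lemma floorlog_growth_mono: "k \<le> l \<Longrightarrow> floorlog 2 (V * W ^ k) \<le> floorlog 2 (V * W ^ l)"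
  by (intro floorlog_mono growth_mono)

lemma time_bound_mono: "k \<le> l \<Longrightarrow> time_bound W V k \<le> time_bound W V l"
  unfolding time_bound_def using floorlog_growth_mono[of k l V]
  by (intro mult_le_mono add_le_mono) auto

text \<open>The second phase starts from values up to \<open>V * W ^ k\<close>, so both phases stay
  below \<open>V * W ^ (k + l)\<close>, and every step may be charged at that final size.\<close>

lemma time_bound_add: "time_bound W V k + time_bound W (V * W ^ k) l \<le> time_bound W V (k + l)"
proof -
  have "floorlog 2 (V * W ^ k) \<le> floorlog 2 (V * W ^ (k + l))"
    by (rule floorlog_growth_mono) simp
  then have "2 * k * (floorlog 2 (V * W ^ k) + 1) \<le> 2 * k * (floorlog 2 (V * W ^ (k + l)) + 1)"
    by (intro mult_le_mono) auto
  then show ?thesis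
    unfolding time_bound_def by (simp add: power_add algebra_simps)
qed

text \<open>The first summands are the charge for testing the sign of one register in
  \<open>IfPos\<close> or \<open>WhilePos\<close>.\<close>

lemma time_bound_Suc: "floorlog 2 V + 1 + time_bound W V k \<le> time_bound W V (Suc k)"
proof -
  have "floorlog 2 V \<le> floorlog 2 (V * W ^ Suc k)"
    using floorlog_growth_mono[of 0 "Suc k" V] by simp
  then have "floorlog 2 V + 1 + 2 * k * (floorlog 2 (V * W ^ k) + 1)
     \<le> 2 * (floorlog 2 (V * W ^ Suc k) + 1) + 2 * k * (floorlog 2 (V * W ^ Suc k) + 1)"
    using floorlog_growth_mono[of k "Suc k" V] by (intro add_mono mult_le_mono) auto
  then show ?thesis unfolding time_bound_def by (simp add: algebra_simps)
qed

lemma bounded_config_growth: "bounded_config V s \<Longrightarrow> bounded_config (V * W ^ k) s"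
  using bounded_config_mono[OF _ growth_mono[of 0 k V]] by simp

lemma runs_weaken: "runs W c s k s' \<Longrightarrow> k \<le> l \<Longrightarrow> runs W c s l s'"
  unfolding runs_def
  by (meson bounded_config_mono growth_mono time_bound_mono order_trans)

lemma runs_Seq: "runs W c s k s' \<Longrightarrow> runs W d s' l s'' \<Longrightarrow> runs W (Seq c d) s (k + l) s''"
  unfolding runs_def
proof (intro allI impI)
  fix V
  assume c: "\<forall>V\<ge>1. bounded_config V s \<longrightarrow> bounded_config (V * W ^ k) s' \<and>
      (\<exists>t. exec c s t s' \<and> t \<le> time_bound W V k)"
    and d: "\<forall>V\<ge>1. bounded_config V s' \<longrightarrow> bounded_config (V * W ^ l) s'' \<and>
      (\<exists>t. exec d s' t s'' \<and> t \<le> time_bound W V l)"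
    and V: "1 \<le> V" "bounded_config V s"
  obtain t where t: "exec c s t s'" "t \<le> time_bound W V k" and b: "bounded_config (V * W ^ k) s'"
    using c V by auto
  have "V * W ^ k \<ge> 1" using V W by simp
  then obtain u where u: "exec d s' u s''" "u \<le> time_bound W (V * W ^ k) l"
    and b': "bounded_config (V * W ^ k * W ^ l) s''"
    using d b by blast
  have "t + u \<le> time_bound W V (k + l)"
    using t(2) u(2) time_bound_add[of V k l] by linarith
  then show "bounded_config (V * W ^ (k + l)) s'' \<and>
      (\<exists>t. exec (Seq c d) s t s'' \<and> t \<le> time_bound W V (k + l))"
    using exec.Seq[OF t(1) u(1)] b' by (auto simp: power_add mult.assoc)
qed

lemma runs_basic:
  assumes "\<And>V. V \<ge> 1 \<Longrightarrow> bounded_config V s \<Longrightarrow>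
     bounded_config (V * W ^ k) s' \<and> (\<exists>t. exec c s t s' \<and> t \<le> 2 * (floorlog 2 (V * W ^ k) + 1))"
    and "k \<ge> 1"
  shows "runs W c s k s'"
  unfolding runs_def
proof (intro allI impI)
  fix V :: nat assume "1 \<le> V" "bounded_config V s"
  moreover have "2 * (floorlog 2 (V * W ^ k) + 1) \<le> time_bound W V k"
    unfolding time_bound_def using \<open>k \<ge> 1\<close> by (intro mult_le_mono) auto
  ultimately show "bounded_config (V * W ^ k) s' \<and> (\<exists>t. exec c s t s' \<and> t \<le> time_bound W V k)"
    using assms(1) order_trans by blast
qed

lemma two_int_size_le:
  assumes "\<bar>x\<bar> \<le> int V" "\<bar>y\<bar> \<le> int V"
  shows "int_size x + int_size y \<le> 2 * (floorlog 2 (V * W ^ Suc 0) + 1)"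
  using int_size_mono[OF assms(1)] int_size_mono[OF assms(2)] floorlog_growth_mono[of 0 1 V]
  by simp

lemma one_int_size_le:
  assumes "\<bar>x\<bar> \<le> int V"
  shows "int_size x \<le> 2 * (floorlog 2 (V * W ^ Suc 0) + 1)"
  using int_size_mono[OF assms(1)] floorlog_growth_mono[of 0 1 V]
  by simp

text \<open>What sums and differences demand of the growth factor: they may double the largest
  value.\<close>

lemma two_V_le: "2 * int V \<le> int (V * W ^ Suc 0)"
proof -
  have "2 * int V = int (V * 2)" by simp
  also have "\<dots> \<le> int (V * W ^ Suc 0)" using W by (intro of_nat_mono) simp
  finally show ?thesis .
qed

lemma V_le: "int V \<le> int (V * W ^ Suc 0)"
  using two_V_le[of V] by linarith

text \<open>A literal may exceed \<open>V * W\<close>, so it counts as \<open>|c| + 1\<close> steps,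
  enough because \<open>|c| < 2 ^ (|c| + 1)\<close>. Literals are part of the program, so this is a
  constant.\<close>

lemma runs_Const: "runs W (Const i c) (X, xs, ys) (nat \<bar>c\<bar> + 1) (X(i := c), xs, ys)"
proof (rule runs_basic)
  fix V :: nat
  assume V: "1 \<le> V" and b: "bounded_config V (X, xs, ys)"
  have "nat \<bar>c\<bar> < 2 ^ (nat \<bar>c\<bar> + 1)" by (rule order_less_trans[OF less_exp]) simp
  also have "(2::nat) ^ (nat \<bar>c\<bar> + 1) \<le> W ^ (nat \<bar>c\<bar> + 1)" using W by (intro power_mono) auto
  also have "\<dots> \<le> V * W ^ (nat \<bar>c\<bar> + 1)" using V by simp
  finally have c: "\<bar>c\<bar> \<le> int (V * W ^ (nat \<bar>c\<bar> + 1))" by linarith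
  have b': "bounded_config (V * W ^ (nat \<bar>c\<bar> + 1)) (X, xs, ys)"
    by (rule bounded_config_growth[OF b])
  then have "bounded_config (V * W ^ (nat \<bar>c\<bar> + 1)) (X(i := c), xs, ys)"
    using c by (auto simp: bounded_config_iff)
  moreover have "int_size c \<le> 2 * (floorlog 2 (V * W ^ (nat \<bar>c\<bar> + 1)) + 1)"
    using int_size_mono[OF c] by simp
  ultimately show "bounded_config (V * W ^ (nat \<bar>c\<bar> + 1)) (X(i := c), xs, ys) \<and>
     (\<exists>t. exec (Const i c) (X, xs, ys) t (X(i := c), xs, ys) \<and>
       t \<le> 2 * (floorlog 2 (V * W ^ (nat \<bar>c\<bar> + 1)) + 1))"
    using exec.Const by blast
qed simp

lemma runs_Const_0: "runs W (Const i 0) (X, xs, ys) 1 (X(i := 0), xs, ys)"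
  using runs_Const[of i 0] by simp

lemma runs_Const_1: "runs W (Const i 1) (X, xs, ys) 2 (X(i := 1), xs, ys)"
  using runs_Const[of i 1 X xs ys] by (simp add: numeral_2_eq_2)

lemma bounded_config_upd:
  assumes "bounded_config V (X, xs, ys)" "\<bar>v\<bar> \<le> int (V * W ^ Suc 0)"
  shows "bounded_config (V * W ^ Suc 0) (X(i := v), xs, ys)"
  using bounded_config_growth[OF assms(1), of "Suc 0"] assms(2)
  by (auto simp: bounded_config_iff)

lemma runs_Add: "runs W (Add i j k) (X, xs, ys) 1 (X(i := X j + X k), xs, ys)"
  unfolding One_nat_def
proof (rule runs_basic)
  fix V :: nat
  assume V: "1 \<le> V" and b: "bounded_config V (X, xs, ys)"
  have X: "\<bar>X j\<bar> \<le> int V" "\<bar>X k\<bar> \<le> int V" using b by (auto simp: bounded_config_iff)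
  then have "\<bar>X j + X k\<bar> \<le> int (V * W ^ Suc 0)" using two_V_le[of V] by linarith
  from bounded_config_upd[OF b this] two_int_size_le[OF X] exec.Add
  show "bounded_config (V * W ^ Suc 0) (X(i := X j + X k), xs, ys) \<and>
     (\<exists>t. exec (Add i j k) (X, xs, ys) t (X(i := X j + X k), xs, ys) \<and>
       t \<le> 2 * (floorlog 2 (V * W ^ Suc 0) + 1))"
    by blast
qed simp

lemma runs_Sub: "runs W (Sub i j k) (X, xs, ys) 1 (X(i := X j - X k), xs, ys)"
  unfolding One_nat_def
proof (rule runs_basic)
  fix V :: nat
  assume V: "1 \<le> V" and b: "bounded_config V (X, xs, ys)"
  have X: "\<bar>X j\<bar> \<le> int V" "\<bar>X k\<bar> \<le> int V" using b by (auto simp: bounded_config_iff)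
  then have "\<bar>X j - X k\<bar> \<le> int (V * W ^ Suc 0)" using two_V_le[of V] by linarith
  from bounded_config_upd[OF b this] two_int_size_le[OF X] exec.Sub
  show "bounded_config (V * W ^ Suc 0) (X(i := X j - X k), xs, ys) \<and>
     (\<exists>t. exec (Sub i j k) (X, xs, ys) t (X(i := X j - X k), xs, ys) \<and>
       t \<le> 2 * (floorlog 2 (V * W ^ Suc 0) + 1))"
    by blast
qed simp

text \<open>Bounding one factor by \<open>W\<close> turns a possible squaring into growth by a
  single factor \<open>W\<close>.\<close>

lemma runs_Mul:
  assumes "\<bar>X j\<bar> \<le> int W"
  shows "runs W (Mul i j k) (X, xs, ys) 1 (X(i := X j * X k), xs, ys)"
  unfolding One_nat_def
proof (rule runs_basic)
  fix V :: nat
  assume V: "1 \<le> V" and b: "bounded_config V (X, xs, ys)"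
  have X: "\<bar>X j\<bar> \<le> int V" "\<bar>X k\<bar> \<le> int V" using b by (auto simp: bounded_config_iff)
  have "\<bar>X j * X k\<bar> \<le> int W * int V" using X assms by (simp add: abs_mult mult_mono)
  then have "\<bar>X j * X k\<bar> \<le> int (V * W ^ Suc 0)" by (simp add: mult.commute)
  from bounded_config_upd[OF b this] two_int_size_le[OF X] exec.Mul
  show "bounded_config (V * W ^ Suc 0) (X(i := X j * X k), xs, ys) \<and>
     (\<exists>t. exec (Mul i j k) (X, xs, ys) t (X(i := X j * X k), xs, ys) \<and>
       t \<le> 2 * (floorlog 2 (V * W ^ Suc 0) + 1))"
    by blast
qed simp

lemma runs_Load:
  assumes "X j \<ge> 0"
  shows "runs W (Load i j) (X, xs, ys) 1 (X(i := X (nat (X j))), xs, ys)"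
  unfolding One_nat_def
proof (rule runs_basic)
  fix V :: nat
  assume V: "1 \<le> V" and b: "bounded_config V (X, xs, ys)"
  have X: "\<bar>X j\<bar> \<le> int V" "\<bar>X (nat (X j))\<bar> \<le> int V" using b by (auto simp: bounded_config_iff)
  from bounded_config_upd[OF b order_trans[OF X(2) V_le]] two_int_size_le[OF X] exec.Load assms
  show "bounded_config (V * W ^ Suc 0) (X(i := X (nat (X j))), xs, ys) \<and>
     (\<exists>t. exec (Load i j) (X, xs, ys) t (X(i := X (nat (X j))), xs, ys) \<and>
       t \<le> 2 * (floorlog 2 (V * W ^ Suc 0) + 1))"
    by blast
qed simp

lemma runs_Store:
  assumes "X i \<ge> 0"
  shows "runs W (Store i j) (X, xs, ys) 1 (X(nat (X i) := X j), xs, ys)"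
  unfolding One_nat_def
proof (rule runs_basic)
  fix V :: nat
  assume V: "1 \<le> V" and b: "bounded_config V (X, xs, ys)"
  have X: "\<bar>X i\<bar> \<le> int V" "\<bar>X j\<bar> \<le> int V" using b by (auto simp: bounded_config_iff)
  from bounded_config_upd[OF b order_trans[OF X(2) V_le]] two_int_size_le[OF X] exec.Store assms
  show "bounded_config (V * W ^ Suc 0) (X(nat (X i) := X j), xs, ys) \<and>
     (\<exists>t. exec (Store i j) (X, xs, ys) t (X(nat (X i) := X j), xs, ys) \<and>
       t \<le> 2 * (floorlog 2 (V * W ^ Suc 0) + 1))"
    by blast
qed simp

lemma runs_Read: "runs W (Read i) (X, x # xs, ys) 1 (X(i := x), xs, ys)"
  unfolding One_nat_def
proof (rule runs_basic)
  fix V :: nat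
  assume V: "1 \<le> V" and b: "bounded_config V (X, x # xs, ys)"
  have X: "\<bar>x\<bar> \<le> int V" and b': "bounded_config V (X, xs, ys)"
    using b by (auto simp: bounded_config_iff)
  from bounded_config_upd[OF b' order_trans[OF X V_le]] one_int_size_le[OF X] exec.Read
  show "bounded_config (V * W ^ Suc 0) (X(i := x), xs, ys) \<and>
     (\<exists>t. exec (Read i) (X, x # xs, ys) t (X(i := x), xs, ys) \<and>
       t \<le> 2 * (floorlog 2 (V * W ^ Suc 0) + 1))"
    by blast
qed simp

lemma runs_Write: "runs W (Write i) (X, xs, ys) 1 (X, xs, ys @ [X i])"
  unfolding One_nat_def
proof (rule runs_basic)
  fix V :: nat
  assume V: "1 \<le> V" and b: "bounded_config V (X, xs, ys)"
  have X: "\<bar>X i\<bar> \<le> int V" using b by (auto simp: bounded_config_iff)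
  have "bounded_config (V * W ^ Suc 0) (X, xs, ys @ [X i])"
    using bounded_config_growth[OF b, of "Suc 0"] by (auto simp: bounded_config_iff)
  with one_int_size_le[OF X] exec.Write
  show "bounded_config (V * W ^ Suc 0) (X, xs, ys @ [X i]) \<and>
     (\<exists>t. exec (Write i) (X, xs, ys) t (X, xs, ys @ [X i]) \<and>
       t \<le> 2 * (floorlog 2 (V * W ^ Suc 0) + 1))"
    by blast
qed simp

lemma runs_Skip: "runs W Skip s 1 s"
  unfolding One_nat_def
proof (rule runs_basic)
  fix V :: nat
  assume V: "1 \<le> V" and b: "bounded_config V s"
  have "bounded_config (V * W ^ Suc 0) s"
    using bounded_config_growth[OF b, of "Suc 0"] by simp
  then show "bounded_config (V * W ^ Suc 0) s \<and>
     (\<exists>t. exec Skip s t s \<and> t \<le> 2 * (floorlog 2 (V * W ^ Suc 0) + 1))"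
    using exec.Skip by (intro conjI exI[of _ 1]) auto
qed simp

lemma runs_Suc:
  assumes "runs W c (X, xs, ys) k s'"
    and "\<And>t. exec c (X, xs, ys) t s' \<Longrightarrow> exec c' (X, xs, ys) (int_size (X i) + t) s'"
  shows "runs W c' (X, xs, ys) (Suc k) s'"
  unfolding runs_def
proof (intro allI impI)
  fix V :: nat
  assume V: "1 \<le> V" and b: "bounded_config V (X, xs, ys)"
  obtain t where t: "exec c (X, xs, ys) t s'" "t \<le> time_bound W V k"
    and b': "bounded_config (V * W ^ k) s'"
    using assms(1) V b unfolding runs_def by blast
  have "\<bar>X i\<bar> \<le> int V" using b by (auto simp: bounded_config_iff)
  then have "int_size (X i) + t \<le> time_bound W V (Suc k)"
    using int_size_mono[of "X i" V] t(2) time_bound_Suc[of V k] by linarith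
  then show "bounded_config (V * W ^ Suc k) s' \<and>
      (\<exists>t. exec c' (X, xs, ys) t s' \<and> t \<le> time_bound W V (Suc k))"
    using assms(2)[OF t(1)] bounded_config_mono[OF b' growth_mono[of k "Suc k" V]] by auto
qed

lemma runs_IfPos:
  assumes "runs W (if X i > 0 then c else d) (X, xs, ys) k s'"
  shows "runs W (IfPos i c d) (X, xs, ys) (Suc k) s'"
  using assms by (rule runs_Suc) (auto intro: exec.IfTrue exec.IfFalse split: if_splits)

lemma runs_WhileFalse:
  assumes "\<not> X i > 0"
  shows "runs W (WhilePos i c) (X, xs, ys) 1 (X, xs, ys)"
  unfolding One_nat_def
proof (rule runs_basic)
  fix V :: nat
  assume V: "1 \<le> V" and b: "bounded_config V (X, xs, ys)"
  have X: "\<bar>X i\<bar> \<le> int V" using b by (auto simp: bounded_config_iff)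
  have "bounded_config (V * W ^ Suc 0) (X, xs, ys)"
    using bounded_config_growth[OF b, of "Suc 0"] by simp
  then show "bounded_config (V * W ^ Suc 0) (X, xs, ys) \<and>
     (\<exists>t. exec (WhilePos i c) (X, xs, ys) t (X, xs, ys) \<and>
       t \<le> 2 * (floorlog 2 (V * W ^ Suc 0) + 1))"
    using one_int_size_le[OF X] exec.WhileFalse[of X, OF assms] by blast
qed simp

lemma runs_WhileTrue:
  assumes "X i > 0" "runs W c (X, xs, ys) k s'" "runs W (WhilePos i c) s' l s''"
  shows "runs W (WhilePos i c) (X, xs, ys) (Suc (k + l)) s''"
  using runs_Seq[OF assms(2,3)]
proof (rule runs_Suc)
  fix t assume "exec (Seq c (WhilePos i c)) (X, xs, ys) t s''"
  then obtain t1 t2 s1 where "exec c (X, xs, ys) t1 s1" "exec (WhilePos i c) s1 t2 s''" "t = t1 + t2"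
    by (auto elim: exec.cases)
  then show "exec (WhilePos i c) (X, xs, ys) (int_size (X i) + t) s''"
    using exec.WhileTrue[of X, OF assms(1)] by (simp add: add.assoc)
qed

end

section \<open>A loop language and its compilation\<close>

type_synonym store = "nat list \<Rightarrow> int"

text \<open>A key is a list of digits below \<open>q\<close>, array indices first and the name of the array last; digits
  out of range are clipped to 0, and so is the first factor of a product, which keeps the growth per
  step bounded by \<open>q\<close>.\<close>

datatype expr =
    Lit int | BndQ | BndM | BndN
  | Plus expr expr | Minus expr expr | Times expr expr | Fetch key
and key = Root | Digit expr key

datatype prog =
    Assign key expr | Input key | Output expr | Nop
  | Comp prog prog (infixr \<open>;;\<close> 60)
  | Cond expr prog prog
  | Loop nat prog

definition clip :: "nat \<Rightarrow> int \<Rightarrow> nat" where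
  "clip q v = (if 0 \<le> v \<and> v < int q then nat v else 0)"

text \<open>A list of \<open>k\<close> digits is sent to \<open>q ^ (k + 1)\<close> plus its value
  in base \<open>q\<close>, first digit least significant. Lists of different lengths get disjoint
  ranges, and the registers below \<open>q\<close> stay free for scratch work.\<close>

primrec addr :: "nat \<Rightarrow> nat list \<Rightarrow> nat" where
  "addr q [] = q"
| "addr q (x # xs) = q * addr q xs + x"

lemma addr_ge: "1 \<le> q \<Longrightarrow> q \<le> addr q xs"
  by (induction xs) (auto intro: order_trans trans_le_add1)

text \<open>A nonempty list has an address of at least \<open>q * q > q\<close>, so \<open>q\<close>
  belongs to the empty list alone; otherwise quotient and remainder by \<open>q\<close> split off
  the first digit.\<close>

lemma addr_inject:
  assumes "2 \<le> q" "\<forall>x\<in>set xs. x < q" "\<forall>y\<in>set ys. y < q" "addr q xs = addr q ys"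
  shows "xs = ys"
  using assms(2-)
proof (induction xs arbitrary: ys)
  have gt: "q < addr q (y # ys)" for y ys
  proof -
    have "q * 2 \<le> q * addr q ys" using addr_ge[of q ys] assms(1) by (intro mult_le_mono) auto
    then show ?thesis using assms(1) unfolding addr.simps by linarith
  qed
  {
    case Nil
    then have "addr q ys = q" by simp
    then show ?case using gt by (metis less_irrefl neq_Nil_conv)
  next
    case (Cons x xs)
    have "ys \<noteq> []" using gt[of x xs] Cons.prems(3) by (auto simp del: addr.simps(2))
    then obtain y zs where ys: "ys = y # zs" by (cases ys) auto
    have *: "q * addr q xs + x = q * addr q zs + y" "x < q" "y < q" using Cons.prems ys by auto
    have "addr q xs = (q * addr q xs + x) div q" using *(2) by simp
    also have "\<dots> = addr q zs" unfolding *(1) using *(3) by simp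
    finally have "addr q xs = addr q zs" .
    then show ?case using *(1) Cons.IH[of zs] Cons.prems(1,2) ys by simp
  }
qed

text \<open>A number of registers, counted from \<open>d\<close>, that suffices as scratch space; it
  has to fit below \<open>q\<close>, where the store begins.\<close>

primrec depth_expr :: "expr \<Rightarrow> nat" and depth_key :: "key \<Rightarrow> nat" where
  "depth_expr (Lit c) = 1"
| "depth_expr BndQ = 1"
| "depth_expr BndM = 1"
| "depth_expr BndN = 1"
| "depth_expr (Plus a b) = Suc (depth_expr a + depth_expr b)"
| "depth_expr (Minus a b) = Suc (depth_expr a + depth_expr b)"
| "depth_expr (Times a b) = 2 + (depth_expr a + depth_expr b)"
| "depth_expr (Fetch k) = depth_key k"
| "depth_key Root = 1"
| "depth_key (Digit e k) = 3 + (depth_expr e + depth_key k)"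

text \<open>The 7 of a loop: two registers for the rounds done and the rounds left, five for the key
  of the loop variable.\<close>

primrec depth :: "prog \<Rightarrow> nat" where
  "depth (Assign k e) = Suc (depth_key k + depth_expr e)"
| "depth (Input k) = 2 + depth_key k"
| "depth (Output e) = depth_expr e"
| "depth Nop = 0"
| "depth (c ;; d) = depth c + depth d"
| "depth (Cond e c d) = depth_expr e + (depth c + depth d)"
| "depth (Loop x c) = 7 + depth c"

text \<open>7 is the cost of \<open>compile_clip\<close>; the sums are bracketed the way
  \<open>runs_Seq\<close> assembles them.\<close>

primrec steps_expr :: "expr \<Rightarrow> nat" and steps_key :: "key \<Rightarrow> nat" where
  "steps_expr (Lit c) = nat \<bar>c\<bar> + 1"
| "steps_expr BndQ = 2"
| "steps_expr BndM = 2"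
| "steps_expr BndN = 2"
| "steps_expr (Plus a b) = steps_expr a + (steps_expr b + 1)"
| "steps_expr (Minus a b) = steps_expr a + (steps_expr b + 1)"
| "steps_expr (Times a b) = steps_expr a + (7 + (steps_expr b + 1))"
| "steps_expr (Fetch k) = steps_key k + 1"
| "steps_key Root = 2"
| "steps_key (Digit e k) = steps_key k + (steps_expr e + (7 + (1 + 1)))"

text \<open>A conditional is charged for both branches, so the count depends on the program and
  \<open>q\<close> but not on the data.\<close>

primrec steps :: "nat \<Rightarrow> prog \<Rightarrow> nat" where
  "steps q (Assign k e) = steps_key k + (steps_expr e + 1)"
| "steps q (Input k) = steps_key k + (1 + 1)"
| "steps q (Output e) = steps_expr e + 1"
| "steps q Nop = 1"
| "steps q (c ;; d) = steps q c + steps q d"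
| "steps q (Cond e c d) = steps_expr e + Suc (steps q c + steps q d)"
| "steps q (Loop x c) = 1 + (1 + Suc (q * Suc
     (steps_key (Digit (Lit (int x)) Root) + (1 + (steps q c + (2 + (1 + 1)))))))"

text \<open>Registers 0, 1, 2 hold \<open>q\<close>, \<open>m\<close>, \<open>n\<close>; an expression is evaluated into register \<open>d\<close>
  with the registers from \<open>d\<close> on as scratch space.\<close>

definition compile_clip :: "nat \<Rightarrow> ram" where
  "compile_clip d =
     Seq (Const (d + 1) 1) (Seq (Add (d + 1) (d + 1) d)
       (IfPos (d + 1)
          (Seq (Sub (d + 1) 0 d) (IfPos (d + 1) Skip (Const d 0)))
          (Const d 0)))"

primrec compile_expr :: "expr \<Rightarrow> nat \<Rightarrow> ram" and compile_key :: "key \<Rightarrow> nat \<Rightarrow> ram" where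
  "compile_expr (Lit c) d = Const d c"
| "compile_expr BndQ d = Seq (Const d 0) (Add d d 0)"
| "compile_expr BndM d = Seq (Const d 0) (Add d d 1)"
| "compile_expr BndN d = Seq (Const d 0) (Add d d 2)"
| "compile_expr (Plus a b) d =
     Seq (compile_expr a d) (Seq (compile_expr b (d + 1)) (Add d d (d + 1)))"
| "compile_expr (Minus a b) d =
     Seq (compile_expr a d) (Seq (compile_expr b (d + 1)) (Sub d d (d + 1)))"
| "compile_expr (Times a b) d =
     Seq (compile_expr a d) (Seq (compile_clip d)
       (Seq (compile_expr b (d + 1)) (Mul d d (d + 1))))"
| "compile_expr (Fetch k) d = Seq (compile_key k d) (Load d d)"
| "compile_key Root d = Seq (Const d 0) (Add d d 0)"
| "compile_key (Digit e k) d =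
     Seq (compile_key k d) (Seq (compile_expr e (d + 1)) (Seq (compile_clip (d + 1))
       (Seq (Mul d 0 d) (Add d d (d + 1)))))"

primrec compile :: "prog \<Rightarrow> nat \<Rightarrow> ram" where
  "compile (Assign k e) d =
     Seq (compile_key k d) (Seq (compile_expr e (d + 1)) (Store d (d + 1)))"
| "compile (Input k) d = Seq (compile_key k d) (Seq (Read (d + 1)) (Store d (d + 1)))"
| "compile (Output e) d = Seq (compile_expr e d) (Write d)"
| "compile Nop d = Skip"
| "compile (c1 ;; c2) d = Seq (compile c1 d) (compile c2 d)"
| "compile (Cond e c1 c2) d = Seq (compile_expr e d) (IfPos d (compile c1 d) (compile c2 d))"
\<comment> \<open>Register \<open>d\<close> counts the finished rounds, \<open>d + 1\<close> the
  rounds left. The loop variable in the store is only a copy, so the body may overwrite it without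
  changing the number of rounds.\<close>
| "compile (Loop x c) d =
     Seq (Const d 0) (Seq (Sub (d + 1) 0 d) (WhilePos (d + 1)
       (Seq (compile_key (Digit (Lit (int x)) Root) (d + 2)) (Seq (Store (d + 2) d)
         (Seq (compile c (d + 2)) (Seq (Const (d + 1) 1)
           (Seq (Add d d (d + 1)) (Sub (d + 1) 0 d))))))))"

section \<open>Semantics of the loop language by weakest preconditions\<close>

context
  fixes q m n :: nat
begin

primrec eval :: "expr \<Rightarrow> store \<Rightarrow> int" and keyval :: "key \<Rightarrow> store \<Rightarrow> nat list" where
  "eval (Lit c) mem = c"
| "eval BndQ mem = int q"
| "eval BndM mem = int m"
| "eval BndN mem = int n"
| "eval (Plus a b) mem = eval a mem + eval b mem"
| "eval (Minus a b) mem = eval a mem - eval b mem"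
| "eval (Times a b) mem = int (clip q (eval a mem)) * eval b mem"
| "eval (Fetch k) mem = mem (keyval k mem)"
| "keyval Root mem = []"
| "keyval (Digit e k) mem = clip q (eval e mem) # keyval k mem"

type_synonym post = "store \<Rightarrow> int list \<Rightarrow> int list \<Rightarrow> bool"

text \<open>\<open>l\<close> is the number of rounds left, so the round at hand has number
  \<open>q - Suc l\<close>; recursion on the rounds left puts the earliest round outermost.\<close>

primrec iterate_wp :: "(nat \<Rightarrow> post \<Rightarrow> post) \<Rightarrow> nat \<Rightarrow> post \<Rightarrow> post" where
  "iterate_wp f 0 P = P"
| "iterate_wp f (Suc l) P = f (q - Suc l) (iterate_wp f l P)"

primrec wp :: "prog \<Rightarrow> post \<Rightarrow> post" where
  "wp (Assign k e) P mem xs ys \<longleftrightarrow> P (mem(keyval k mem := eval e mem)) xs ys"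
| "wp (Input k) P mem xs ys \<longleftrightarrow>
     xs \<noteq> [] \<and> P (mem(keyval k mem := hd xs)) (tl xs) ys"
| "wp (Output e) P mem xs ys \<longleftrightarrow> P mem xs (ys @ [eval e mem])"
| "wp Nop P mem xs ys \<longleftrightarrow> P mem xs ys"
| "wp (c ;; d) P mem xs ys \<longleftrightarrow> wp c (wp d P) mem xs ys"
| "wp (Cond e c d) P mem xs ys \<longleftrightarrow>
     (if eval e mem > 0 then wp c P mem xs ys else wp d P mem xs ys)"
| "wp (Loop x c) P mem xs ys \<longleftrightarrow>
     iterate_wp (\<lambda>t R mem. wp c R (mem([clip q (int x)] := int t))) q P mem xs ys"

lemma iterate_wp_mono:
  assumes "\<And>t R R' mem xs ys. f t R mem xs ys \<Longrightarrow> (\<And>mem xs ys. R mem xs ys \<Longrightarrow> R' mem xs ys)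
      \<Longrightarrow> f t R' mem xs ys"
    and "iterate_wp f l P mem xs ys" "\<And>mem xs ys. P mem xs ys \<Longrightarrow> P' mem xs ys"
  shows "iterate_wp f l P' mem xs ys"
  using assms(2)
proof (induction l arbitrary: mem xs ys)
  case (Suc l)
  then show ?case by (auto intro: assms(1))
qed (simp add: assms(3))

lemma wp_mono:
  "wp c P mem xs ys \<Longrightarrow> (\<And>mem xs ys. P mem xs ys \<Longrightarrow> P' mem xs ys) \<Longrightarrow> wp c P' mem xs ys"
proof (induction c arbitrary: P P' mem xs ys)
  case (Comp c1 c2)
  show ?case unfolding wp.simps
    by (rule Comp.IH(1)[OF Comp.prems(1)[unfolded wp.simps]]) (erule Comp.IH(2), erule Comp.prems(2))
next
  case (Loop x c)
  show ?case unfolding wp.simps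
    by (rule iterate_wp_mono[OF _ Loop.prems(1)[unfolded wp.simps] Loop.prems(2)]) (rule Loop.IH)
qed (auto split: if_splits)

text \<open>\<open>I t\<close> is the invariant after \<open>t\<close> rounds. The number of rounds
  is fixed, so termination asks for no variant, and the proof is an induction on the rounds
  left.\<close>

lemma wp_Loop:
  assumes init: "I 0 mem xs ys"
    and step: "\<And>t mem xs ys. t < q \<Longrightarrow> I t mem xs ys \<Longrightarrow>
      wp c (I (Suc t)) (mem([clip q (int x)] := int t)) xs ys"
    and post: "\<And>mem xs ys. I q mem xs ys \<Longrightarrow> P mem xs ys"
  shows "wp (Loop x c) P mem xs ys"
proof -
  let ?f = "\<lambda>t R mem. wp c R (mem([clip q (int x)] := int t))"
  have "l \<le> q \<Longrightarrow> I (q - l) mem xs ys \<Longrightarrow> iterate_wp ?f l P mem xs ys" for l mem xs ys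
  proof (induction l arbitrary: mem xs ys)
    case (Suc l)
    have "Suc (q - Suc l) = q - l" using Suc.prems by simp
    then have *: "wp c (I (q - l)) (mem([clip q (int x)] := int (q - Suc l))) xs ys"
      using step[of "q - Suc l" mem xs ys] Suc.prems by simp
    show ?case unfolding iterate_wp.simps by (rule wp_mono[OF *]) (rule Suc.IH, use Suc.prems in auto)
  qed (simp add: post)
  from this[of q mem xs ys] show ?thesis using init by simp
qed

text \<open>Only keys with digits below \<open>q\<close> are tied to registers;
  \<open>keyval\<close> yields no others, because every digit is clipped.\<close>

definition represents :: "(nat \<Rightarrow> int) \<Rightarrow> store \<Rightarrow> bool" where
  "represents X mem \<longleftrightarrow> X 0 = int q \<and> X 1 = int m \<and> X 2 = int n \<and>
     (\<forall>ds. (\<forall>d\<in>set ds. d < q) \<longrightarrow> X (addr q ds) = mem ds)"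

section \<open>Correctness of the compilation\<close>

context
  assumes q: "2 \<le> q"
begin

lemma clip_less: "clip q v < q"
  using q by (auto simp: clip_def)

lemma keyval_less: "x \<in> set (keyval k mem) \<Longrightarrow> x < q"
  by (induction k rule: key.induct[of "\<lambda>_. True"]) (use clip_less in auto)

lemma addr_ge': "q \<le> addr q ds"
  using q addr_ge by simp

text \<open>The frame condition of expression code: registers below \<open>d\<close> hold pending
  values, those from \<open>q\<close> on hold the store.\<close>

definition agrees :: "nat \<Rightarrow> (nat \<Rightarrow> int) \<Rightarrow> (nat \<Rightarrow> int) \<Rightarrow> bool" where
  "agrees d X Y \<longleftrightarrow> (\<forall>r. r < d \<or> q \<le> r \<longrightarrow> Y r = X r)"

lemma agrees_low: "agrees d X Y \<Longrightarrow> r < d \<Longrightarrow> Y r = X r"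
  by (simp add: agrees_def)

lemma agrees_high: "agrees d X Y \<Longrightarrow> q \<le> r \<Longrightarrow> Y r = X r"
  by (simp add: agrees_def)

lemma agrees_refl: "agrees d X X"
  by (simp add: agrees_def)

lemma agrees_trans: "agrees d X Y \<Longrightarrow> agrees e Y Z \<Longrightarrow> d \<le> e \<Longrightarrow> agrees d X Z"
  by (simp add: agrees_def)

lemma agrees_upd: "agrees d X Y \<Longrightarrow> d \<le> r \<Longrightarrow> r < q \<Longrightarrow> agrees d X (Y(r := v))"
  by (simp add: agrees_def)

lemma represents_agrees:
  assumes "represents X mem" "agrees d X X'" "3 \<le> d"
  shows "represents X' mem"
  using assms(1) addr_ge' agrees_low[OF assms(2)] agrees_high[OF assms(2)] assms(3)
  by (simp add: represents_def)

lemma represents_0: "represents X mem \<Longrightarrow> X 0 = int q"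
  by (simp add: represents_def)

lemma represents_fetch: "represents X mem \<Longrightarrow> X (addr q (keyval k mem)) = mem (keyval k mem)"
  using keyval_less by (simp add: represents_def)

text \<open>By \<open>addr_inject\<close> no other key shares the register, and
  \<open>3 <= q\<close> keeps the registers of \<open>q\<close>, \<open>m\<close>, \<open>n\<close>
  out of reach.\<close>

lemma represents_store:
  assumes "represents X mem" "\<forall>d\<in>set ds. d < q" "3 \<le> q"
  shows "represents (X(addr q ds := v)) (mem(ds := v))"
  using assms(1,3) addr_ge'[of ds] addr_inject[OF q _ assms(2)] by (auto simp: represents_def)

text \<open>Only signs can be tested, so \<open>0 <= X d\<close> is tested as
  \<open>1 + X d > 0\<close> and \<open>X d < q\<close> as \<open>q - X d > 0\<close>.\<close>

lemma runs_clip: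
  assumes "X 0 = int q" "1 \<le> d" "d + 2 \<le> q"
  shows "\<exists>X'. runs q (compile_clip d) (X, xs, ys) 7 (X', xs, ys) \<and> X' d = int (clip q (X d)) \<and>
     agrees d X X'"
proof -
  define X1 where "X1 = X(d + 1 := 1)"
  define X2 where "X2 = X1(d + 1 := X1 (d + 1) + X1 d)"
  have r1: "runs q (Const (d + 1) 1) (X, xs, ys) 2 (X1, xs, ys)"
    unfolding X1_def by (rule runs_Const_1[OF q])
  have r2: "runs q (Add (d + 1) (d + 1) d) (X1, xs, ys) 1 (X2, xs, ys)"
    unfolding X2_def by (rule runs_Add[OF q])
  have X2d: "X2 (d + 1) = 1 + X d" "X2 d = X d" "X2 0 = int q"
    using assms by (auto simp: X1_def X2_def)
  define X3 where "X3 = X2(d + 1 := X2 0 - X2 d)"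
  have r3: "runs q (Sub (d + 1) 0 d) (X2, xs, ys) 1 (X3, xs, ys)"
    unfolding X3_def by (rule runs_Sub[OF q])
  define X4 where "X4 = (if 1 + X d > 0 then if int q - X d > 0 then X3 else X3(d := 0) else X2(d := 0))"
  have r4: "runs q (if X3 (d + 1) > 0 then Skip else Const d 0) (X3, xs, ys) 1
      (if int q - X d > 0 then X3 else X3(d := 0), xs, ys)"
    using runs_Skip[OF q] runs_Const_0[OF q, of d] X2d by (auto simp: X3_def)
  have r0: "runs q (Const d 0) (X2, xs, ys) 3 (X2(d := 0), xs, ys)"
    by (rule runs_weaken[OF q runs_Const_0[OF q]]) simp
  have r5: "runs q (if X2 (d + 1) > 0 then Seq (Sub (d + 1) 0 d) (IfPos (d + 1) Skip (Const d 0))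
      else Const d 0) (X2, xs, ys) (1 + Suc 1) (X4, xs, ys)"
    using runs_Seq[OF q r3 runs_IfPos[OF q r4]] r0 X2d
    unfolding X4_def by (auto simp: eval_nat_numeral)
  have "runs q (compile_clip d) (X, xs, ys) (2 + (1 + Suc (1 + Suc 1))) (X4, xs, ys)"
    unfolding compile_clip_def by (intro runs_Seq[OF q r1] runs_Seq[OF q r2] runs_IfPos[OF q] r5)
  moreover have "X4 d = int (clip q (X d))" using X2d by (auto simp: X4_def X3_def clip_def)
  moreover have "agrees d X X4"
    using assms(3) by (auto simp: X4_def X3_def X2_def X1_def intro!: agrees_upd agrees_refl)
  ultimately show ?thesis by (auto simp: eval_nat_numeral)
qed

lemma runs_bound:
  assumes "X b = v" "b < 3" "3 \<le> d" "d < q"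
  shows "\<exists>X'. runs q (Seq (Const d 0) (Add d d b)) (X, xs, ys) 2 (X', xs, ys) \<and> X' d = v \<and>
     agrees d X X'"
proof -
  have "runs q (Seq (Const d 0) (Add d d b)) (X, xs, ys) (1 + 1)
      ((X(d := 0))(d := (X(d := 0)) d + (X(d := 0)) b), xs, ys)"
    by (rule runs_Seq[OF q runs_Const_0[OF q] runs_Add[OF q]])
  then have "runs q (Seq (Const d 0) (Add d d b)) (X, xs, ys) 2 (X(d := v), xs, ys)"
    using assms by (simp add: numeral_2_eq_2)
  then show ?thesis
    by (rule_tac exI, intro conjI) (assumption, use \<open>d < q\<close> in \<open>auto intro: agrees_upd agrees_refl\<close>)
qed

text \<open>Simultaneous induction, as expressions and keys contain each other. The frame condition
  \<open>agrees\<close> lets the first operand, left in register \<open>d\<close>, survive the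
  evaluation of the second from \<open>d + 1\<close> on.\<close>

lemma
  shows runs_expr: "represents X mem \<Longrightarrow> 3 \<le> d \<Longrightarrow> d + depth_expr e \<le> q \<Longrightarrow>
      \<exists>X'. runs q (compile_expr e d) (X, xs, ys) (steps_expr e) (X', xs, ys) \<and>
        X' d = eval e mem \<and> agrees d X X'"
    and runs_key: "represents X mem \<Longrightarrow> 3 \<le> d \<Longrightarrow> d + depth_key k \<le> q \<Longrightarrow>
      \<exists>X'. runs q (compile_key k d) (X, xs, ys) (steps_key k) (X', xs, ys) \<and>
        X' d = int (addr q (keyval k mem)) \<and> agrees d X X'"
proof (induction e and k arbitrary: X d and X d)
  case (Lit c)
  have A: "agrees d X (X(d := c))" using Lit by (simp add: agrees_upd agrees_refl)
  have V: "(X(d := c)) d = c" by simp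
  show ?case unfolding compile_expr.simps steps_expr.simps eval.simps
    by (intro exI conjI, rule runs_Const[OF q], rule V, rule A)
next
  case BndQ
  then have "X 0 = int q" "d < q" "3 \<le> d" by (simp_all add: represents_def)
  then show ?case unfolding compile_expr.simps steps_expr.simps eval.simps by (intro runs_bound) simp_all
next
  case BndM
  then have "X 1 = int m" "d < q" "3 \<le> d" by (simp_all add: represents_def)
  then show ?case unfolding compile_expr.simps steps_expr.simps eval.simps by (intro runs_bound) simp_all
next
  case BndN
  then have "X 2 = int n" "d < q" "3 \<le> d" by (simp_all add: represents_def)
  then show ?case unfolding compile_expr.simps steps_expr.simps eval.simps by (intro runs_bound) simp_all
next
  case (Plus a b)
  have dep: "d + depth_expr a \<le> q" "3 \<le> d + 1" "d + 1 + depth_expr b \<le> q" "d < q"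
    using Plus.prems by simp_all
  obtain X1 where 1: "runs q (compile_expr a d) (X, xs, ys) (steps_expr a) (X1, xs, ys)"
    "X1 d = eval a mem" "agrees d X X1"
    using Plus.IH(1)[OF Plus.prems(1,2) dep(1)] by blast
  have R1: "represents X1 mem" using Plus.prems(1) 1(3) Plus.prems(2) by (rule represents_agrees)
  obtain X2 where 2: "runs q (compile_expr b (d + 1)) (X1, xs, ys) (steps_expr b) (X2, xs, ys)"
    "X2 (d + 1) = eval b mem" "agrees (d + 1) X1 X2"
    using Plus.IH(2)[OF R1 dep(2,3)] by blast
  let ?X = "X2(d := X2 d + X2 (d + 1))"
  have 3: "runs q (Add d d (d + 1)) (X2, xs, ys) 1 (?X, xs, ys)" by (rule runs_Add[OF q])
  have V: "?X d = eval (Plus a b) mem" using agrees_low[OF 2(3), of d] 1(2) 2(2) by simp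
  have A: "agrees d X ?X"
    using agrees_trans[OF 1(3) 2(3)] dep(4) by (simp add: agrees_upd)
  show ?case
    unfolding compile_expr.simps steps_expr.simps
    by (intro exI conjI, rule runs_Seq[OF q 1(1) runs_Seq[OF q 2(1) 3]], rule V, rule A)
next
  case (Minus a b)
  have dep: "d + depth_expr a \<le> q" "3 \<le> d + 1" "d + 1 + depth_expr b \<le> q" "d < q"
    using Minus.prems by simp_all
  obtain X1 where 1: "runs q (compile_expr a d) (X, xs, ys) (steps_expr a) (X1, xs, ys)"
    "X1 d = eval a mem" "agrees d X X1"
    using Minus.IH(1)[OF Minus.prems(1,2) dep(1)] by blast
  have R1: "represents X1 mem" using Minus.prems(1) 1(3) Minus.prems(2) by (rule represents_agrees)
  obtain X2 where 2: "runs q (compile_expr b (d + 1)) (X1, xs, ys) (steps_expr b) (X2, xs, ys)"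
    "X2 (d + 1) = eval b mem" "agrees (d + 1) X1 X2"
    using Minus.IH(2)[OF R1 dep(2,3)] by blast
  let ?X = "X2(d := X2 d - X2 (d + 1))"
  have 3: "runs q (Sub d d (d + 1)) (X2, xs, ys) 1 (?X, xs, ys)" by (rule runs_Sub[OF q])
  have V: "?X d = eval (Minus a b) mem" using agrees_low[OF 2(3), of d] 1(2) 2(2) by simp
  have A: "agrees d X ?X"
    using agrees_trans[OF 1(3) 2(3)] dep(4) by (simp add: agrees_upd)
  show ?case
    unfolding compile_expr.simps steps_expr.simps
    by (intro exI conjI, rule runs_Seq[OF q 1(1) runs_Seq[OF q 2(1) 3]], rule V, rule A)
next
  case (Times a b)
  have dep: "d + depth_expr a \<le> q" "3 \<le> d + 1" "d + 1 + depth_expr b \<le> q" "d < q" "1 \<le> d" "d + 2 \<le> q"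
    using Times.prems by simp_all
  obtain X1 where 1: "runs q (compile_expr a d) (X, xs, ys) (steps_expr a) (X1, xs, ys)"
    "X1 d = eval a mem" "agrees d X X1"
    using Times.IH(1)[OF Times.prems(1,2) dep(1)] by blast
  have R1: "represents X1 mem" using Times.prems(1) 1(3) Times.prems(2) by (rule represents_agrees)
  obtain X2 where 2: "runs q (compile_clip d) (X1, xs, ys) 7 (X2, xs, ys)"
    "X2 d = int (clip q (X1 d))" "agrees d X1 X2"
    using runs_clip[of X1 d xs ys, OF represents_0[OF R1] dep(5,6)] by blast
  have R2: "represents X2 mem" using R1 2(3) Times.prems(2) by (rule represents_agrees)
  obtain X3 where 3: "runs q (compile_expr b (d + 1)) (X2, xs, ys) (steps_expr b) (X3, xs, ys)"
    "X3 (d + 1) = eval b mem" "agrees (d + 1) X2 X3"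
    using Times.IH(2)[OF R2 dep(2,3)] by blast
  have X3d: "X3 d = int (clip q (X1 d))" using agrees_low[OF 3(3), of d] 2(2) by simp
  then have "\<bar>X3 d\<bar> \<le> int q" using clip_less[of "X1 d"] by simp
  then have 4: "runs q (Mul d d (d + 1)) (X3, xs, ys) 1 (X3(d := X3 d * X3 (d + 1)), xs, ys)"
    by (rule runs_Mul[OF q])
  let ?X = "X3(d := X3 d * X3 (d + 1))"
  have V: "?X d = eval (Times a b) mem" using X3d 1(2) 3(2) by simp
  have A: "agrees d X ?X"
    using agrees_trans[OF agrees_trans[OF 1(3) 2(3)] 3(3)] dep(4) by (simp add: agrees_upd)
  show ?case
    unfolding compile_expr.simps steps_expr.simps
    by (intro exI conjI, rule runs_Seq[OF q 1(1) runs_Seq[OF q 2(1) runs_Seq[OF q 3(1) 4]]], rule V, rule A)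
next
  case (Fetch k)
  have dep: "d + depth_key k \<le> q" "d < q" using Fetch.prems by simp_all (cases k; simp)
  obtain X1 where 1: "runs q (compile_key k d) (X, xs, ys) (steps_key k) (X1, xs, ys)"
    "X1 d = int (addr q (keyval k mem))" "agrees d X X1"
    using Fetch.IH[OF Fetch.prems(1,2) dep(1)] by blast
  have R1: "represents X1 mem" using Fetch.prems(1) 1(3) Fetch.prems(2) by (rule represents_agrees)
  have 2: "runs q (Load d d) (X1, xs, ys) 1 (X1(d := X1 (nat (X1 d))), xs, ys)"
    by (rule runs_Load[OF q]) (simp add: 1(2))
  let ?X = "X1(d := X1 (nat (X1 d)))"
  have V: "?X d = eval (Fetch k) mem" using represents_fetch[OF R1] by (simp add: 1(2))
  have A: "agrees d X ?X" using 1(3) dep(2) by (simp add: agrees_upd)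
  show ?case
    unfolding compile_expr.simps steps_expr.simps
    by (intro exI conjI, rule runs_Seq[OF q 1(1) 2], rule V, rule A)
next
  case Root
  then have "X 0 = int q" "d < q" "3 \<le> d" by (simp_all add: represents_def)
  then show ?case unfolding compile_key.simps steps_key.simps keyval.simps addr.simps by (intro runs_bound) simp_all
next
  case (Digit e k)
  have dep: "d + depth_key k \<le> q" "3 \<le> d + 1" "d + 1 + depth_expr e \<le> q" "d < q" "1 \<le> d + 1"
    "d + 1 + 2 \<le> q"
    using Digit.prems by simp_all
  obtain X1 where 1: "runs q (compile_key k d) (X, xs, ys) (steps_key k) (X1, xs, ys)"
    "X1 d = int (addr q (keyval k mem))" "agrees d X X1"
    using Digit.IH(2)[OF Digit.prems(1,2) dep(1)] by blast
  have R1: "represents X1 mem" using Digit.prems(1) 1(3) Digit.prems(2) by (rule represents_agrees)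
  obtain X2 where 2: "runs q (compile_expr e (d + 1)) (X1, xs, ys) (steps_expr e) (X2, xs, ys)"
    "X2 (d + 1) = eval e mem" "agrees (d + 1) X1 X2"
    using Digit.IH(1)[OF R1 dep(2,3)] by blast
  have R2: "represents X2 mem" using R1 2(3) dep(2) by (rule represents_agrees)
  obtain X3 where 3: "runs q (compile_clip (d + 1)) (X2, xs, ys) 7 (X3, xs, ys)"
    "X3 (d + 1) = int (clip q (X2 (d + 1)))" "agrees (d + 1) X2 X3"
    using runs_clip[of X2 "d + 1" xs ys, OF represents_0[OF R2] dep(5,6)] by blast
  have R3: "represents X3 mem" using R2 3(3) dep(2) by (rule represents_agrees)
  have X3d: "X3 d = int (addr q (keyval k mem))"
    using agrees_low[OF 3(3), of d] agrees_low[OF 2(3), of d] 1(2) by simp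
  have "\<bar>X3 0\<bar> \<le> int q" using represents_0[OF R3] by simp
  let ?X4 = "X3(d := X3 0 * X3 d)"
  let ?X = "?X4(d := ?X4 d + ?X4 (d + 1))"
  from \<open>\<bar>X3 0\<bar> \<le> int q\<close> have 4: "runs q (Mul d 0 d) (X3, xs, ys) 1 (?X4, xs, ys)"
    by (rule runs_Mul[OF q])
  have 5: "runs q (Add d d (d + 1)) (?X4, xs, ys) 1 (?X, xs, ys)"
    by (rule runs_Add[OF q])
  have V: "?X d = int (addr q (keyval (Digit e k) mem))" using X3d 2(2) 3(2) represents_0[OF R3] by simp
  have A: "agrees d X ?X"
    using agrees_trans[OF agrees_trans[OF 1(3) 2(3)] 3(3)] dep(4) by (simp add: agrees_upd)
  show ?case
    unfolding compile_key.simps steps_key.simps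
    by (intro exI conjI, rule runs_Seq[OF q 1(1) runs_Seq[OF q 2(1) runs_Seq[OF q 3(1) runs_Seq[OF q 4 5]]]], rule V, rule A)
qed

lemma runs_Store_represents:
  assumes "represents X mem" "X i = int (addr q ds)" "\<forall>d\<in>set ds. d < q" "3 \<le> d" "d \<le> q"
  shows "\<exists>X'. runs q (Store i j) (X, xs, ys) 1 (X', xs, ys) \<and> represents X' (mem(ds := X j)) \<and>
     (\<forall>r<d. X' r = X r)"
proof -
  have 1: "runs q (Store i j) (X, xs, ys) 1 (X(addr q ds := X j), xs, ys)"
    using runs_Store[OF q, of X i j xs ys] assms(2) by simp
  have 2: "represents (X(addr q ds := X j)) (mem(ds := X j))"
    using assms by (intro represents_store) auto
  have 3: "\<forall>r<d. (X(addr q ds := X j)) r = X r" using assms(5) addr_ge'[of ds] by auto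
  show ?thesis by (intro exI conjI, rule 1, rule 2, rule 3)
qed

text \<open>Whatever \<open>wp\<close> guarantees holds on the machine. Registers below
  \<open>d\<close> are preserved because the counters of the enclosing loops live there.\<close>

lemma runs_compile:
  "wp c P mem xs ys \<Longrightarrow> represents X mem \<Longrightarrow> 3 \<le> d \<Longrightarrow> d + depth c \<le> q \<Longrightarrow>
     \<exists>X' mem' xs' ys'. runs q (compile c d) (X, xs, ys) (steps q c) (X', xs', ys') \<and>
       P mem' xs' ys' \<and> represents X' mem' \<and> (\<forall>r<d. X' r = X r)"
proof (induction c arbitrary: P X mem xs ys d)
  case (Assign k e)
  have dep: "d + depth_key k \<le> q" "3 \<le> d + 1" "d + 1 + depth_expr e \<le> q" "d \<le> q"
    using Assign.prems by simp_all
  obtain X1 where 1: "runs q (compile_key k d) (X, xs, ys) (steps_key k) (X1, xs, ys)"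
    "X1 d = int (addr q (keyval k mem))" "agrees d X X1"
    using runs_key[OF Assign.prems(2,3) dep(1)] by blast
  have R1: "represents X1 mem" using Assign.prems(2) 1(3) Assign.prems(3) by (rule represents_agrees)
  obtain X2 where 2: "runs q (compile_expr e (d + 1)) (X1, xs, ys) (steps_expr e) (X2, xs, ys)"
    "X2 (d + 1) = eval e mem" "agrees (d + 1) X1 X2"
    using runs_expr[OF R1 dep(2,3)] by blast
  have R2: "represents X2 mem" using R1 2(3) dep(2) by (rule represents_agrees)
  have X2d: "X2 d = int (addr q (keyval k mem))" using agrees_low[OF 2(3), of d] 1(2) by simp
  have k: "\<forall>x\<in>set (keyval k mem). x < q" using keyval_less by blast
  obtain X3 where 3: "runs q (Store d (d + 1)) (X2, xs, ys) 1 (X3, xs, ys)"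
    "represents X3 (mem(keyval k mem := X2 (d + 1)))" "\<forall>r<d. X3 r = X2 r"
    using runs_Store_represents[OF R2 X2d k Assign.prems(3) dep(4)] by blast
  have A: "\<forall>r<d. X3 r = X r" using 3(3) agrees_low[OF 2(3)] agrees_low[OF 1(3)] by simp
  show ?case
    unfolding compile.simps steps.simps
    by (intro exI conjI, rule runs_Seq[OF q 1(1) runs_Seq[OF q 2(1) 3(1)]],
      rule Assign.prems(1)[unfolded wp.simps], rule 3(2)[unfolded 2(2)], rule A)
next
  case (Input k)
  have dep: "d + depth_key k \<le> q" "3 \<le> d + 1" "d + 1 < q" "d \<le> q"
    using Input.prems by simp_all
  obtain x xs' where xs: "xs = x # xs'" using Input.prems by (cases xs) auto
  obtain X1 where 1: "runs q (compile_key k d) (X, xs, ys) (steps_key k) (X1, xs, ys)"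
    "X1 d = int (addr q (keyval k mem))" "agrees d X X1"
    using runs_key[OF Input.prems(2,3) dep(1)] by blast
  have R1: "represents X1 mem" using Input.prems(2) 1(3) Input.prems(3) by (rule represents_agrees)
  let ?X2 = "X1(d + 1 := x)"
  have 2: "runs q (Read (d + 1)) (X1, xs, ys) 1 (?X2, xs', ys)"
    unfolding xs by (rule runs_Read[OF q])
  have A2: "agrees (d + 1) X1 ?X2" using dep(3) by (simp add: agrees_upd agrees_refl)
  have R2: "represents ?X2 mem" using R1 A2 dep(2) by (rule represents_agrees)
  have X2d: "?X2 d = int (addr q (keyval k mem))" using 1(2) by simp
  have k: "\<forall>x\<in>set (keyval k mem). x < q" using keyval_less by blast
  obtain X3 where 3: "runs q (Store d (d + 1)) (?X2, xs', ys) 1 (X3, xs', ys)"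
    "represents X3 (mem(keyval k mem := ?X2 (d + 1)))" "\<forall>r<d. X3 r = ?X2 r"
    using runs_Store_represents[OF R2 X2d k Input.prems(3) dep(4)] by blast
  have A: "\<forall>r<d. X3 r = X r" using 3(3) agrees_low[OF A2] agrees_low[OF 1(3)] by simp
  have R: "represents X3 (mem(keyval k mem := x))" using 3(2) by simp
  have P: "P (mem(keyval k mem := x)) xs' ys" using Input.prems(1) xs by simp
  show ?case
    unfolding compile.simps steps.simps
    by (intro exI conjI, rule runs_Seq[OF q 1(1) runs_Seq[OF q 2 3(1)]], rule P, rule R, rule A)
next
  case (Output e)
  have dep: "d + depth_expr e \<le> q" using Output.prems by simp
  obtain X1 where 1: "runs q (compile_expr e d) (X, xs, ys) (steps_expr e) (X1, xs, ys)"
    "X1 d = eval e mem" "agrees d X X1"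
    using runs_expr[OF Output.prems(2,3) dep(1)] by blast
  have R1: "represents X1 mem" using Output.prems(2) 1(3) Output.prems(3) by (rule represents_agrees)
  have 2: "runs q (Write d) (X1, xs, ys) 1 (X1, xs, ys @ [eval e mem])"
    using runs_Write[OF q, of d X1 xs ys] 1(2) by simp
  have A: "\<forall>r<d. X1 r = X r" using agrees_low[OF 1(3)] by simp
  show ?case
    unfolding compile.simps steps.simps
    by (intro exI conjI, rule runs_Seq[OF q 1(1) 2], rule Output.prems(1)[unfolded wp.simps], rule R1, rule A)
next
  case Nop
  show ?case unfolding compile.simps steps.simps
    by (intro exI conjI, rule runs_Skip[OF q], rule Nop.prems(1)[unfolded wp.simps], rule Nop.prems(2), simp)
next
  case (Comp c1 c2)
  have dep: "d + depth c1 \<le> q" "d + depth c2 \<le> q" using Comp.prems by simp_all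
  obtain X1 mem1 xs1 ys1 where 1: "runs q (compile c1 d) (X, xs, ys) (steps q c1) (X1, xs1, ys1)"
    "wp c2 P mem1 xs1 ys1" "represents X1 mem1" "\<forall>r<d. X1 r = X r"
    using Comp.IH(1)[OF Comp.prems(1)[unfolded wp.simps] Comp.prems(2,3) dep(1)] by blast
  obtain X2 mem2 xs2 ys2 where 2: "runs q (compile c2 d) (X1, xs1, ys1) (steps q c2) (X2, xs2, ys2)"
    "P mem2 xs2 ys2" "represents X2 mem2" "\<forall>r<d. X2 r = X1 r"
    using Comp.IH(2)[OF 1(2,3) Comp.prems(3) dep(2)] by blast
  have A: "\<forall>r<d. X2 r = X r" using 1(4) 2(4) by simp
  show ?case
    unfolding compile.simps steps.simps
    by (intro exI conjI, rule runs_Seq[OF q 1(1) 2(1)], rule 2(2), rule 2(3), rule A)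
next
  case (Cond e c1 c2)
  have dep: "d + depth_expr e \<le> q" "d + depth c1 \<le> q" "d + depth c2 \<le> q"
    using Cond.prems by simp_all
  obtain X1 where 1: "runs q (compile_expr e d) (X, xs, ys) (steps_expr e) (X1, xs, ys)"
    "X1 d = eval e mem" "agrees d X X1"
    using runs_expr[OF Cond.prems(2,3) dep(1)] by blast
  have R1: "represents X1 mem" using Cond.prems(2) 1(3) Cond.prems(3) by (rule represents_agrees)
  \<comment> \<open>Either branch is padded to the sum of both step counts.\<close>
  have "\<exists>X' mem' xs' ys'. runs q (if X1 d > 0 then compile c1 d else compile c2 d) (X1, xs, ys)
       (steps q c1 + steps q c2) (X', xs', ys') \<and>
       P mem' xs' ys' \<and> represents X' mem' \<and> (\<forall>r<d. X' r = X1 r)"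
  proof (cases "X1 d > 0")
    case True
    then have "wp c1 P mem xs ys" using Cond.prems(1) 1(2) by simp
    from Cond.IH(1)[OF this R1 Cond.prems(3) dep(2)] show ?thesis
      unfolding if_P[OF True] using runs_weaken[OF q _ le_add1] by blast
  next
    case False
    then have "wp c2 P mem xs ys" using Cond.prems(1) 1(2) by simp
    from Cond.IH(2)[OF this R1 Cond.prems(3) dep(3)] show ?thesis
      unfolding if_not_P[OF False] using runs_weaken[OF q _ le_add2] by blast
  qed
  then obtain X' mem' xs' ys' where 2: "runs q (if X1 d > 0 then compile c1 d else compile c2 d) (X1, xs, ys)
       (steps q c1 + steps q c2) (X', xs', ys')"
       "P mem' xs' ys'" "represents X' mem'" "\<forall>r<d. X' r = X1 r"
    by blast
  have A: "\<forall>r<d. X' r = X r" using agrees_low[OF 1(3)] 2(4) by simp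
  show ?case
    unfolding compile.simps steps.simps
    by (intro exI conjI, rule runs_Seq[OF q 1(1) runs_IfPos[OF q 2(1)]], rule 2(2), rule 2(3), rule A)
next
  case (Loop x c)
  let ?f = "\<lambda>t R mem. wp c R (mem([clip q (int x)] := int t))"
  let ?k = "Digit (Lit (int x)) Root"
  let ?b = "steps_key ?k + (1 + (steps q c + (2 + (1 + 1))))"
  let ?B = "Seq (compile_key ?k (d + 2)) (Seq (Store (d + 2) d)
         (Seq (compile c (d + 2)) (Seq (Const (d + 1) 1)
           (Seq (Add d d (d + 1)) (Sub (d + 1) 0 d)))))"
  have dep: "3 \<le> d + 2" "d + 2 + depth_key ?k \<le> q" "d + 2 \<le> q" "d + 2 + depth c \<le> q" "d + 1 < q"
    using Loop.prems by simp_all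
  have k: "keyval ?k mem = [clip q (int x)]" for mem by simp
  have kq: "\<forall>x\<in>set [clip q (int x)]. x < q" using clip_less by simp
  have loop: "\<exists>X' mem' xs' ys'. runs q (WhilePos (d + 1) ?B) (X, xs, ys) (Suc (l * Suc ?b)) (X', xs', ys') \<and>
       P mem' xs' ys' \<and> represents X' mem' \<and> (\<forall>r<d. X' r = X r)"
    if "iterate_wp ?f l P mem xs ys" "l \<le> q" "represents X mem" "X d = int (q - l)" "X (d + 1) = int l"
    for l X mem xs ys
    using that
  proof (induction l arbitrary: X mem xs ys)
    case 0
    have 1: "runs q (WhilePos (d + 1) ?B) (X, xs, ys) (Suc (0 * Suc ?b)) (X, xs, ys)"
      using runs_WhileFalse[OF q, of X "d + 1" ?B xs ys] 0(5) by simp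
    show ?case
      by (intro exI conjI, rule 1, rule 0(1)[unfolded iterate_wp.simps], rule 0(3), simp)
  next
    case (Suc l)
    let ?t = "q - Suc l"
    obtain X1 where 1: "runs q (compile_key ?k (d + 2)) (X, xs, ys) (steps_key ?k) (X1, xs, ys)"
      "X1 (d + 2) = int (addr q (keyval ?k mem))" "agrees (d + 2) X X1"
      using runs_key[OF Suc.prems(3) dep(1,2)] by blast
    have R1: "represents X1 mem" using Suc.prems(3) 1(3) dep(1) by (rule represents_agrees)
    have X1d: "X1 d = int ?t" using agrees_low[OF 1(3), of d] Suc.prems(4) by simp
    obtain X2 where 2: "runs q (Store (d + 2) d) (X1, xs, ys) 1 (X2, xs, ys)"
      "represents X2 (mem([clip q (int x)] := int ?t))" "\<forall>r<d + 2. X2 r = X1 r"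
      using runs_Store_represents[OF R1 1(2)[unfolded k] kq dep(1,3), of d] unfolding X1d by blast
    have "wp c (iterate_wp ?f l P) (mem([clip q (int x)] := int ?t)) xs ys"
      using Suc.prems(1) unfolding iterate_wp.simps .
    from Loop.IH[OF this 2(2) dep(1,4)] obtain X3 mem3 xs3 ys3 where
      3: "runs q (compile c (d + 2)) (X2, xs, ys) (steps q c) (X3, xs3, ys3)"
      "iterate_wp ?f l P mem3 xs3 ys3" "represents X3 mem3" "\<forall>r<d + 2. X3 r = X2 r"
      by blast
    let ?X4 = "X3(d + 1 := 1)"
    let ?X5 = "?X4(d := ?X4 d + ?X4 (d + 1))"
    let ?X6 = "?X5(d + 1 := ?X5 0 - ?X5 d)"
    have 4: "runs q (Const (d + 1) 1) (X3, xs3, ys3) 2 (?X4, xs3, ys3)" by (rule runs_Const_1[OF q])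
    have 5: "runs q (Add d d (d + 1)) (?X4, xs3, ys3) 1 (?X5, xs3, ys3)" by (rule runs_Add[OF q])
    have 6: "runs q (Sub (d + 1) 0 d) (?X5, xs3, ys3) 1 (?X6, xs3, ys3)" by (rule runs_Sub[OF q])
    note B = runs_Seq[OF q 1(1) runs_Seq[OF q 2(1) runs_Seq[OF q 3(1) runs_Seq[OF q 4 runs_Seq[OF q 5 6]]]]]
    have A6: "agrees d X3 ?X6" using dep(5) by (intro agrees_upd agrees_refl) auto
    have R6: "represents ?X6 mem3" using 3(3) A6 Loop.prems(3) by (rule represents_agrees)
    have "X3 d = int ?t" using X1d 2(3) 3(4) by simp
    then have X6d: "?X6 d = int (q - l)" using Suc.prems(2) by simp
    have e: "?X6 (d + 1) = int q - ?X6 d" using represents_0[OF 3(3)] Loop.prems(3) by simp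
    have X6e: "?X6 (d + 1) = int l" unfolding e X6d using Suc.prems(2) by (simp add: of_nat_diff)
    from Suc.IH[OF 3(2) _ R6 X6d X6e] Suc.prems(2) obtain X' mem' xs' ys' where
      7: "runs q (WhilePos (d + 1) ?B) (?X6, xs3, ys3) (Suc (l * Suc ?b)) (X', xs', ys')"
       "P mem' xs' ys'" "represents X' mem'" "\<forall>r<d. X' r = ?X6 r"
      using Suc_leD by blast
    have "X (d + 1) > 0" using Suc.prems(5) by simp
    from runs_WhileTrue[OF q this B 7(1)]
    have 8: "runs q (WhilePos (d + 1) ?B) (X, xs, ys) (Suc (Suc l * Suc ?b)) (X', xs', ys')" by simp
    have "X' r = X r" if "r < d" for r
      using 7(4) agrees_low[OF A6 that] 3(4) 2(3) agrees_low[OF 1(3), of r] that by simp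
    then have A: "\<forall>r<d. X' r = X r" by simp
    show ?case by (intro exI conjI, rule 8, rule 7(2), rule 7(3), rule A)
  qed
  let ?X1 = "X(d := 0)"
  let ?X2 = "?X1(d + 1 := ?X1 0 - ?X1 d)"
  have 1: "runs q (Const d 0) (X, xs, ys) 1 (?X1, xs, ys)" by (rule runs_Const_0[OF q])
  have 2: "runs q (Sub (d + 1) 0 d) (?X1, xs, ys) 1 (?X2, xs, ys)" by (rule runs_Sub[OF q])
  have A2: "agrees d X ?X2" using dep(5) by (intro agrees_upd agrees_refl) auto
  have R2: "represents ?X2 mem" using Loop.prems(2) A2 Loop.prems(3) by (rule represents_agrees)
  have X2d: "?X2 d = int (q - q)" "?X2 (d + 1) = int q"
    using represents_0[OF Loop.prems(2)] Loop.prems(3) by simp_all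
  obtain X' mem' xs' ys' where
    3: "runs q (WhilePos (d + 1) ?B) (?X2, xs, ys) (Suc (q * Suc ?b)) (X', xs', ys')"
       "P mem' xs' ys'" "represents X' mem'" "\<forall>r<d. X' r = ?X2 r"
    using loop[OF Loop.prems(1)[unfolded wp.simps] order_refl R2 X2d] by blast
  have A: "\<forall>r<d. X' r = X r" using 3(4) agrees_low[OF A2] by simp
  show ?case
    unfolding compile.simps steps.simps
    by (intro exI conjI, rule runs_Seq[OF q 1 runs_Seq[OF q 2 3(1)]],
      rule 3(2), rule 3(3), rule A)
qed

end

end

section \<open>From step counts to a polynomial in the input length\<close>

lemma steps_poly: "\<exists>p. \<forall>q. steps q c = poly p q"
proof (induction c)
  case (Comp c d)
  then obtain p r where "\<forall>q. steps q c = poly p q" "\<forall>q. steps q d = poly r q" by blast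
  then show ?case by (intro exI[of _ "p + r"]) simp
next
  case (Cond e c d)
  then obtain p r where "\<forall>q. steps q c = poly p q" "\<forall>q. steps q d = poly r q" by blast
  then show ?case by (intro exI[of _ "[:Suc (steps_expr e):] + p + r"]) simp
next
  case (Loop x c)
  then obtain p where p: "\<forall>q. steps q c = poly p q" by blast
  let ?k = "steps_key (Digit (Lit (int x)) Root)"
  show ?case
    using p by (intro exI[of _ "[:3:] + [:0, 1:] * ([:Suc (?k + 5):] + p)"]) (simp add: algebra_simps)
next
  case (Assign k e)
  then show ?case by (intro exI[of _ "[:steps_key k + (steps_expr e + 1):]"]) simp
next
  case (Input k)
  then show ?case by (intro exI[of _ "[:steps_key k + (1 + 1):]"]) simp
next
  case (Output e)
  then show ?case by (intro exI[of _ "[:steps_expr e + 1:]"]) simp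
next
  case Nop
  then show ?case by (intro exI[of _ "[:1:]"]) simp
qed

lemma poly_nat_mono: "x \<le> y \<Longrightarrow> poly p x \<le> poly (p :: nat poly) y"
  by (induction p) (auto intro!: add_mono mult_mono)

text \<open>\<open>q\<close> itself bounds its number of digits; this crude estimate makes the
  right-hand side a polynomial in \<open>L\<close>, \<open>T\<close> and \<open>q\<close>.\<close>

lemma time_bound_le:
  "time_bound q (2 ^ L) T \<le> 2 * T * (L + T * q + 3)"
proof -
  have "q < 2 ^ q" by (rule less_exp)
  then have "floorlog 2 q \<le> q" by (intro floorlog_leI) auto
  then have "T * floorlog 2 q \<le> T * q" by simp
  moreover have "floorlog 2 (2 ^ L * q ^ T) \<le> floorlog 2 (1 * 2 ^ L) + (T * floorlog 2 q + 1)"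
    using floorlog_mult_le[of "2 ^ L" "q ^ T"] floorlog_power_le[of q T] by simp
  moreover have "floorlog 2 (1 * 2 ^ L) = 1 + L"
    by (subst floorlog_power) (auto simp: floorlog_def)
  ultimately have "floorlog 2 (2 ^ L * q ^ T) + 1 \<le> L + T * q + 3" by linarith
  then show ?thesis unfolding time_bound_def by (intro mult_le_mono) auto
qed

lemma int_size_le_input_length: "x \<in> set xs \<Longrightarrow> int_size x \<le> input_length xs"
  unfolding input_length_def by (simp add: member_le_sum_list)

text \<open>Even 0 has size 1, so the number of listed values, and with it \<open>m\<close> and
  \<open>n\<close>, is bounded by the input length.\<close>

lemma length_le_input_length: "length xs \<le> input_length xs"
  by (induction xs) (auto simp: input_length_def int_size_def)

lemma abs_le_power_int_size: "\<bar>x\<bar> \<le> int (2 ^ int_size x)"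
proof -
  have "nat \<bar>x\<bar> < 2 ^ floorlog 2 (nat \<bar>x\<bar>)" by (rule floorlog_leD) auto
  also have "\<dots> \<le> 2 ^ int_size x" unfolding int_size_def by (intro power_increasing) auto
  finally show ?thesis by linarith
qed

text \<open>The bounds on \<open>m\<close> and \<open>n\<close> make \<open>q\<close> polynomial in
  the input length. In \<open>K\<close>, \<open>depth c\<close> makes room for the scratch registers
  below \<open>q\<close>, and 16, the largest array name of the program below, is a margin for names
  and small numerals.\<close>

lemma prog_polytime:
  fixes c :: prog
  defines "K \<equiv> 16 + depth c"
  shows "\<exists>P p. \<forall>m n xs Q. m \<le> length xs \<longrightarrow> n \<le> length xs \<longrightarrow>
    wp ((m + K) * (n + K)) m n c (\<lambda>_ _ ys. Q ys) (\<lambda>_. 0) xs [] \<longrightarrow>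
    (\<exists>ys t. Q ys \<and> halts_with P (int m # int n # xs) ys t \<and>
      t \<le> poly p (input_length (int m # int n # xs)))"
proof -
  obtain ps where ps: "\<And>q. steps q c = poly ps q" using steps_poly by blast
  define pq :: "nat poly" where "pq = [:K, 1:] * [:K, 1:]"
  define pT where "pT = [:K + 7:] + pcompose ps pq"
  define p where "p = 2 * pT * ([:0, 1:] + pT * pq + 3)"
  \<comment> \<open>The prologue puts \<open>m\<close> and \<open>n\<close> into registers 1 and 2
    and \<open>(m + K) * (n + K)\<close> into register 0; register 3 then serves as first scratch
    register.\<close>
  define P where "P = Seq (Read 1) (Seq (Read 2) (Seq (Const 3 (int K)) (Seq (Add 0 1 3)
    (Seq (Add 3 2 3) (Seq (Mul 0 0 3) (compile c 3))))))"
  show ?thesis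
  proof (intro exI[of _ P] exI[of _ p] allI impI)
    fix m n :: nat and xs :: "int list" and Q
    assume m: "m \<le> length xs" and n: "n \<le> length xs"
      and wp: "wp ((m + K) * (n + K)) m n c (\<lambda>_ _ ys. Q ys) (\<lambda>_. 0) xs []"
    define q where "q = (m + K) * (n + K)"
    let ?in = "int m # int n # xs"
    define L where "L = input_length ?in"
    have mL: "m \<le> L" "n \<le> L"
      using length_le_input_length[of ?in] m n by (auto simp: L_def)
    have Kq: "(m + K) * 16 \<le> q" "16 * (n + K) \<le> q" unfolding q_def by (rule mult_le_mono; simp add: K_def)+
    then have q2: "2 \<le> q" and dq: "3 + depth c \<le> q" and mq: "m + K \<le> q" by (auto simp: K_def)
    define X1 where "X1 = (\<lambda>_ :: nat. 0 :: int)(1 := int m)"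
    define X2 where "X2 = X1(2 := int n)"
    define X3 where "X3 = X2(3 := int K)"
    define X4 where "X4 = X3(0 := X3 1 + X3 3)"
    define X5 where "X5 = X4(3 := X4 2 + X4 3)"
    define X6 where "X6 = X5(0 := X5 0 * X5 3)"
    have r1: "runs q (Read 1) (\<lambda>_. 0, ?in, []) 1 (X1, int n # xs, [])"
      unfolding X1_def by (rule runs_Read[OF q2])
    have r2: "runs q (Read 2) (X1, int n # xs, []) 1 (X2, xs, [])"
      unfolding X2_def by (rule runs_Read[OF q2])
    have r3: "runs q (Const 3 (int K)) (X2, xs, []) (nat \<bar>int K\<bar> + 1) (X3, xs, [])"
      unfolding X3_def by (rule runs_Const[OF q2])
    have r4: "runs q (Add 0 1 3) (X3, xs, []) 1 (X4, xs, [])"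
      unfolding X4_def by (rule runs_Add[OF q2])
    have r5: "runs q (Add 3 2 3) (X4, xs, []) 1 (X5, xs, [])"
      unfolding X5_def by (rule runs_Add[OF q2])
    have X5: "X5 0 = int (m + K)" "X5 3 = int (n + K)" "X5 1 = int m" "X5 2 = int n"
      by (simp_all add: X1_def X2_def X3_def X4_def X5_def)
    have "\<bar>X5 0\<bar> \<le> int q" unfolding X5 using mq by simp
    then have r6: "runs q (Mul 0 0 3) (X5, xs, []) 1 (X6, xs, [])"
      unfolding X6_def by (rule runs_Mul[OF q2])
    have "represents q m n X6 (\<lambda>_. 0)"
    proof -
      have "X6 (addr q ds) = 0" for ds
        using addr_ge[of q ds] dq mq K_def by (auto simp: X1_def X2_def X3_def X4_def X5_def X6_def)
      moreover have "X6 0 = int q" "X6 1 = int m" "X6 2 = int n"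
        using X5 by (simp_all add: X6_def q_def)
      ultimately show ?thesis by (simp add: represents_def)
    qed
    from runs_compile[OF q2 wp[folded q_def] this order_refl dq]
    obtain X' xs' ys' where
      r7: "runs q (compile c 3) (X6, xs, []) (steps q c) (X', xs', ys')" and Q: "Q ys'" by blast
    define T where "T = 1 + (1 + (nat \<bar>int K\<bar> + 1 + (1 + (1 + (1 + steps q c)))))"
    have r: "runs q P (\<lambda>_. 0, ?in, []) T (X', xs', ys')"
      unfolding P_def T_def
      by (rule runs_Seq[OF q2 r1 runs_Seq[OF q2 r2 runs_Seq[OF q2 r3 runs_Seq[OF q2 r4
            runs_Seq[OF q2 r5 runs_Seq[OF q2 r6 r7]]]]]])
    \<comment> \<open>The initial value bound is \<open>V = 2 ^ L\<close>, as no input integer has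
      more than \<open>L\<close> digits.\<close>
    have "bounded_config (2 ^ L) (\<lambda>_. 0, ?in, [])"
      unfolding bounded_config_iff
    proof (intro conjI ballI allI)
      fix x assume "x \<in> set ?in"
      then have "int_size x \<le> L" unfolding L_def by (rule int_size_le_input_length)
      then have "(2::nat) ^ int_size x \<le> 2 ^ L" by (intro power_increasing) auto
      then have "int (2 ^ int_size x) \<le> int (2 ^ L)" by (rule of_nat_mono)
      then show "\<bar>x\<bar> \<le> int (2 ^ L)" using abs_le_power_int_size[of x] by linarith
    qed simp
    then obtain t where t: "exec P (\<lambda>_. 0, ?in, []) t (X', xs', ys')" "t \<le> time_bound q (2 ^ L) T"
      using r unfolding runs_def by (metis one_le_numeral one_le_power)
    have qL: "q \<le> poly pq L"
    proof -
      have "q \<le> (L + K) * (L + K)" unfolding q_def using mL by (intro mult_le_mono) auto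
      then show ?thesis by (simp add: pq_def algebra_simps)
    qed
    have "T \<le> K + 7 + poly ps (poly pq L)"
      using poly_nat_mono[OF qL, of ps] by (simp add: T_def ps)
    then have TL: "T \<le> poly pT L" by (simp add: pT_def poly_pcompose)
    have "t \<le> 2 * T * (L + T * q + 3)" using t(2) time_bound_le order_trans by blast
    also have "\<dots> \<le> 2 * poly pT L * (L + poly pT L * poly pq L + 3)"
      using TL qL by (intro mult_le_mono add_le_mono) auto
    also have "\<dots> = poly p L" by (simp add: p_def)
    finally have "t \<le> poly p L" .
    then show "\<exists>ys t. Q ys \<and> halts_with P ?in ys t \<and> t \<le> poly p (input_length ?in)"
      using Q t(1) unfolding halts_with_def L_def by blast
  qed
qed

section \<open>The Gale-Ryser condition\<close>

definition count_above :: "nat \<Rightarrow> (nat \<Rightarrow> nat) \<Rightarrow> nat \<Rightarrow> nat" where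
  "count_above n cl k = card {j. j < n \<and> k < cl j}"

lemma sum_of_bool_less: "(\<Sum>k<J. of_bool (k < x)) = min x (J::nat)"
  by (induction J) (auto simp: min_def)

lemma count_above_eq_sum: "count_above n cl k = (\<Sum>j<n. of_bool (k < cl j))"
proof -
  have "{j. j < n \<and> k < cl j} = {j \<in> {..<n}. k < cl j}" by auto
  then show ?thesis by (simp add: count_above_def sum.If_cases of_bool_def Int_def)
qed

text \<open>The cells of the Ferrers diagram of \<open>cl\<close> below height \<open>J\<close>,
  counted by levels and by columns.\<close>

lemma sum_count_above: "(\<Sum>k<J. count_above n cl k) = (\<Sum>j<n. min (cl j) J)"
  unfolding count_above_eq_sum by (subst sum.swap) (simp add: sum_of_bool_less)

text \<open>The conjugate partition of \<open>cl\<close> is \<open>count_above n cl\<close>, indexed from 0.\<close>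

definition gale_ryser :: "nat \<Rightarrow> nat list \<Rightarrow> (nat \<Rightarrow> nat) \<Rightarrow> bool" where
  "gale_ryser n rs cl \<longleftrightarrow> sorted_wrt (\<ge>) rs \<and>
     (\<forall>J\<le>length rs. sum_list (take J rs) \<le> (\<Sum>k<J. count_above n cl k)) \<and>
     sum_list rs = (\<Sum>j<n. cl j)"

lemma gale_ryser_Nil: "gale_ryser n [] cl \<Longrightarrow> j < n \<Longrightarrow> cl j = 0"
  by (simp add: gale_ryser_def)

lemma gale_ryser_hd_le: "gale_ryser n (r # rs) cl \<Longrightarrow> r \<le> count_above n cl 0"
  unfolding gale_ryser_def by (auto dest!: spec[of _ 1])

text \<open>A set of columns with largest values is nested with every superlevel set of
  \<open>cl\<close>, so the intersection is the smaller of the two.\<close>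

lemma card_top_inter:
  assumes "S \<subseteq> {..<n}" "\<And>x y. x \<in> S \<Longrightarrow> y < n \<Longrightarrow> y \<notin> S \<Longrightarrow> cl y \<le> (cl x :: nat)"
  shows "card {j \<in> S. k < cl j} = min (card S) (count_above n cl k)"
proof -
  have fin: "finite S" using assms(1) finite_subset by blast
  let ?T = "{j. j < n \<and> k < cl j}"
  have eq: "{j \<in> S. k < cl j} = S \<inter> ?T" using assms(1) by auto
  have "S \<subseteq> ?T \<or> ?T \<subseteq> S" using assms by (force simp: subset_iff)
  then show ?thesis
  proof
    assume "S \<subseteq> ?T"
    then have "S \<inter> ?T = S" "card S \<le> card ?T" by (auto intro: card_mono)
    then show ?thesis unfolding eq count_above_def by simp
  next
    assume "?T \<subseteq> S"
    then have "S \<inter> ?T = ?T" "card ?T \<le> card S" using fin by (auto intro: card_mono)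
    then show ?thesis unfolding eq count_above_def by simp
  qed
qed

text \<open>In the prefix sums of the conjugate partition, the change caused by one greedy row telescopes.\<close>

lemma gale_ryser_greedy:
  assumes gr: "gale_ryser n (r # rs) cl"
    and S: "S \<subseteq> {..<n}" "card S = r"
    and top: "\<And>x y. x \<in> S \<Longrightarrow> y < n \<Longrightarrow> y \<notin> S \<Longrightarrow> cl y \<le> cl x"
  shows "gale_ryser n rs (\<lambda>j. if j \<in> S then cl j - 1 else cl j)" "\<And>x. x \<in> S \<Longrightarrow> 0 < cl x"
proof -
  let ?cl = "\<lambda>j. if j \<in> S then cl j - 1 else cl j"
  have fin: "finite S" using S(1) finite_subset by blast
  have ti: "card {j \<in> S. k < cl j} = min r (count_above n cl k)" for k
    using card_top_inter[of S n cl k, OF S(1) top] S(2) by simp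
  \<comment> \<open>The inequality for one row says that at least \<open>r\<close> columns are
    nonzero, hence all chosen ones are.\<close>
  have "card {j \<in> S. 0 < cl j} = card S"
    using ti[of 0] gale_ryser_hd_le[OF gr] S(2) by simp
  then have "{j \<in> S. 0 < cl j} = S" using fin by (intro card_subset_eq) auto
  then show pos: "\<And>x. x \<in> S \<Longrightarrow> 0 < cl x" by blast
  \<comment> \<open>Level \<open>k\<close> loses the chosen columns above \<open>k\<close> and keeps
    those of them still above \<open>Suc k\<close>; the additive form avoids truncated
    subtraction.\<close>
  have cnt: "count_above n ?cl k + min r (count_above n cl k) = count_above n cl k + min r (count_above n cl (Suc k))"
    for k
  proof -
    have "{j. j < n \<and> k < ?cl j} = {j \<in> S. Suc k < cl j} \<union> ({j. j < n \<and> k < cl j} - {j \<in> S. k < cl j})"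
      using S(1) by auto
    moreover have "card ({j \<in> S. Suc k < cl j} \<union> ({j. j < n \<and> k < cl j} - {j \<in> S. k < cl j}))
      = card {j \<in> S. Suc k < cl j} + card ({j. j < n \<and> k < cl j} - {j \<in> S. k < cl j})"
      using fin by (intro card_Un_disjoint) auto
    moreover have "card ({j. j < n \<and> k < cl j} - {j \<in> S. k < cl j})
        = count_above n cl k - card {j \<in> S. k < cl j}"
      unfolding count_above_def using S(1) fin by (intro card_Diff_subset) auto
    ultimately have "count_above n ?cl k =
        min r (count_above n cl (Suc k)) + (count_above n cl k - min r (count_above n cl k))"
      unfolding count_above_def[of n ?cl] by (simp only: ti)
    then show ?thesis by linarith
  qed
  have tele: "(\<Sum>k<J. count_above n ?cl k) + min r (count_above n cl 0) =
      (\<Sum>k<J. count_above n cl k) + min r (count_above n cl J)" for J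
  proof (induction J)
    case (Suc J)
    then show ?case using cnt[of J] by simp
  qed simp
  have srt: "sorted_wrt (\<ge>) (r # rs)" and
    pre: "\<And>J. J \<le> Suc (length rs) \<Longrightarrow> sum_list (take J (r # rs)) \<le> (\<Sum>k<J. count_above n cl k)" and
    tot: "r + sum_list rs = (\<Sum>j<n. cl j)"
    using gr by (auto simp: gale_ryser_def)
  have "sum_list (take J rs) \<le> (\<Sum>k<J. count_above n ?cl k)" if J: "J \<le> length rs" for J
  proof -
    \<comment> \<open>The two values of the minimum need different bounds. If it is
      \<open>count_above n cl J\<close>, the old inequality for \<open>Suc J\<close> rows
      (\<open>a\<close>) suffices; if it is \<open>r\<close>, the old one for \<open>J\<close> rows
      does (\<open>b\<close>), since by sortedness the first \<open>J\<close> entries of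
      \<open>rs\<close> sum to no more than those of \<open>r # rs\<close>.\<close>
    have t: "(\<Sum>k<J. count_above n ?cl k) + r = (\<Sum>k<J. count_above n cl k) + min r (count_above n cl J)"
      using tele[of J] gale_ryser_hd_le[OF gr] by simp
    have a: "r + sum_list (take J rs) \<le> (\<Sum>k<J. count_above n cl k) + count_above n cl J"
      using pre[of "Suc J"] J by simp
    have b: "sum_list (take J rs) \<le> (\<Sum>k<J. count_above n cl k)"
    proof (cases J)
      case (Suc J')
      then have "rs ! J' \<le> r" "J' < length rs" using srt J by auto
      then have "sum_list (take J rs) = sum_list (take J' rs) + rs ! J'"
        unfolding Suc by (simp add: take_Suc_conv_app_nth)
      also have "\<dots> \<le> sum_list (take J (r # rs))" using \<open>rs ! J' \<le> r\<close> unfolding Suc by simp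
      also have "\<dots> \<le> (\<Sum>k<J. count_above n cl k)" using J by (intro pre) simp
      finally show ?thesis .
    qed simp
    show ?thesis using t a b by linarith
  qed
  moreover have "sum_list rs = (\<Sum>j<n. ?cl j)"
  proof -
    have "(\<Sum>j<n. ?cl j) + card S = (\<Sum>j<n. ?cl j + of_bool (j \<in> S))"
      using S(1) by (simp add: sum.distrib Int_absorb1)
    also have "\<dots> = (\<Sum>j<n. cl j)" using pos by (intro sum.cong) (auto simp: Suc_leI)
    finally show ?thesis using tot S(2) by linarith
  qed
  ultimately show "gale_ryser n rs ?cl" using srt by (simp add: gale_ryser_def)
qed

section \<open>Admissible row and column sums as paths of the dynamic program\<close>

context
  fixes m :: nat
begin

text \<open>\<open>completion l r c D rs cs\<close>: with \<open>l\<close> rows and \<open>c\<close> columns still to be fixed, no further row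
  sum above \<open>r\<close>, no further column sum below \<open>m - l\<close> and slack \<open>D\<close> in the Gale-Ryser inequality
  reached so far, the remaining row sums \<open>rs\<close> and column sums \<open>cs\<close> are admissible.\<close>

inductive completion :: "nat \<Rightarrow> nat \<Rightarrow> nat \<Rightarrow> nat \<Rightarrow> nat list \<Rightarrow> nat list \<Rightarrow> bool" where
  finish: "completion 0 r 0 0 [] []"
| lower: "completion l r c D rs cs \<Longrightarrow> completion l (Suc r) c D rs cs"
| take_col: "completion l r c D rs cs \<Longrightarrow> completion l r (Suc c) D rs (cs @ [m - l])"
| take_row: "completion l r c (D + c - r) rs cs \<Longrightarrow> r \<le> D + c \<Longrightarrow>
    completion (Suc l) r c D (r # rs) cs"

text \<open>A completion ends with slack 0, and only the \<open>l\<close> remaining rows, each at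
  most \<open>r\<close>, can use slack up. This bounds the state space.\<close>

lemma completion_slack: "completion l r c D rs cs \<Longrightarrow> D \<le> l * r"
  by (induction rule: completion.induct) auto

definition length_above :: "nat list \<Rightarrow> nat \<Rightarrow> nat" where
  "length_above cs k = length (filter (\<lambda>x. k < x) cs)"

lemma length_above_all: "\<forall>x\<in>set cs. k < x \<Longrightarrow> length_above cs k = length cs"
  by (simp add: length_above_def)

text \<open>Gale-Ryser as seen from an intermediate state: \<open>D\<close> is the credit left by
  the rows already fixed, and levels are counted from \<open>m - l\<close>.\<close>

lemma completion_admissible:
  assumes "completion l r c D rs cs" "l \<le> m"
  shows "length rs = l \<and> length cs = c \<and> sorted_wrt (\<ge>) rs \<and> (\<forall>x\<in>set rs. x \<le> r) \<and>
     (\<forall>x\<in>set cs. m - l \<le> x \<and> x \<le> m) \<and>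
     (\<forall>J\<le>l. sum_list (take J rs) \<le> D + (\<Sum>k<J. length_above cs (m - l + k))) \<and>
     sum_list rs = D + (\<Sum>k<l. length_above cs (m - l + k))"
  using assms
proof (induction rule: completion.induct)
  case (take_col l r c D rs cs)
  have "length_above (cs @ [m - l]) (m - l + k) = length_above cs (m - l + k)" for k
    by (simp add: length_above_def)
  then show ?case using take_col by auto
next
  case (take_row l r c D rs cs)
  note IH = take_row.IH[OF Suc_leD[OF take_row.prems]]
  have m: "m - Suc l + Suc k = m - l + k" for k using take_row.prems by simp
  \<comment> \<open>All remaining columns exceed level \<open>m - Suc l\<close>, so \<open>c\<close>
    is the next part of the conjugate partition.\<close>
  have "length_above cs (m - Suc l) = c" using IH take_row.prems by (subst length_above_all) auto
  then have shift: "(\<Sum>k<Suc J. length_above cs (m - Suc l + k)) = c + (\<Sum>k<J. length_above cs (m - l + k))" for J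
    by (subst sum.lessThan_Suc_shift) (simp add: m del: add_Suc_right)
  have "sum_list (take J (r # rs)) \<le> D + (\<Sum>k<J. length_above cs (m - Suc l + k))" if "J \<le> Suc l" for J
  proof (cases J)
    case (Suc J')
    then have "sum_list (take J' rs) \<le> D + c - r + (\<Sum>k<J'. length_above cs (m - l + k))"
      using IH that by simp
    then show ?thesis unfolding Suc shift using take_row.hyps(2) by simp
  qed simp
  moreover have "sum_list (r # rs) = D + (\<Sum>k<Suc l. length_above cs (m - Suc l + k))"
    unfolding shift using IH take_row.hyps(2) by simp
  moreover have "\<forall>x\<in>set cs. m - Suc l \<le> x \<and> x \<le> m" using IH by (meson diff_le_mono2 le_SucI order_refl order_trans)
  ultimately show ?case using IH by auto
qed (auto simp: le_Suc_eq)

text \<open>The rule is forced: take a column with sum \<open>m - l\<close> if there is one,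
  otherwise lower \<open>r\<close> to the largest row sum, then take that row. Once
  \<open>l = 0\<close>, a column still left would have to exceed \<open>m\<close>.\<close>

lemma admissible_completion:
  assumes "l \<le> m" "length rs = l" "length cs = c" "sorted_wrt (\<ge>) rs" "\<forall>x\<in>set rs. x \<le> r"
    "sorted_wrt (\<ge>) cs" "\<forall>x\<in>set cs. m - l \<le> x \<and> x \<le> m"
    "\<forall>J\<le>l. sum_list (take J rs) \<le> D + (\<Sum>k<J. length_above cs (m - l + k))"
    "sum_list rs = D + (\<Sum>k<l. length_above cs (m - l + k))"
  shows "completion l r c D rs cs"
  using assms
proof (induction "l + r + c" arbitrary: l r c D rs cs rule: less_induct)
  case less
  show ?case
  proof (cases "cs \<noteq> [] \<and> last cs = m - l")
    case True
    then obtain cs' where cs: "cs = cs' @ [m - l]" by (metis append_butlast_last_id)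
    have eq: "length_above cs (m - l + k) = length_above cs' (m - l + k)" for k
      by (simp add: length_above_def cs)
    have "completion l r (length cs') D rs cs'"
      using less.prems unfolding eq by (intro less.hyps) (auto simp: cs sorted_wrt_append)
    then show ?thesis using take_col less.prems cs by auto
  next
    case False
    have above: "\<forall>x\<in>set cs. m - l < x"
    proof (cases cs rule: rev_cases)
      case (snoc cs' x)
      then have "m - l < x" using False less.prems(7) by (auto simp: le_less)
      then show ?thesis using less.prems(6) snoc by (fastforce simp: sorted_wrt_append)
    qed simp
    show ?thesis
    proof (cases l)
      case 0
      then have "cs = []" using above less.prems(7) by (cases cs) force+
      then show ?thesis using less.prems 0 completion.finish by simp
    next
      case (Suc l')
      then obtain x rs' where rs: "rs = x # rs'" using less.prems(2) by (cases rs) auto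
      show ?thesis
      proof (cases "x < r")
        case True
        then obtain r' where r: "r = Suc r'" by (cases r) auto
        have "completion l r' c D rs cs"
        proof (rule less.hyps)
          show "\<forall>y\<in>set rs. y \<le> r'" using True r less.prems(4) by (auto simp: rs)
        qed (use less.prems r in auto)
        then show ?thesis unfolding r by (rule lower)
      next
        case False
        then have x: "x = r" using less.prems(5) rs by auto
        have m: "m - Suc l' + Suc k = m - l' + k" for k using less.prems(1) Suc by simp
        have "length_above cs (m - Suc l') = c"
          using above less.prems(3) Suc by (subst length_above_all) auto
        then have shift: "(\<Sum>k<Suc J. length_above cs (m - Suc l' + k)) = c + (\<Sum>k<J. length_above cs (m - l' + k))" for J
          by (subst sum.lessThan_Suc_shift) (simp add: m del: add_Suc_right)
        have pre: "r + sum_list (take J rs') \<le> D + (c + (\<Sum>k<J. length_above cs (m - l' + k)))" if "J \<le> l'" for J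
          using less.prems(8)[rule_format, of "Suc J"] that unfolding Suc shift rs x by simp
        have rD: "r \<le> D + c" using pre[of 0] by simp
        have "completion l' r c (D + c - r) rs' cs"
        proof (rule less.hyps)
          show "\<forall>J\<le>l'. sum_list (take J rs') \<le> D + c - r + (\<Sum>k<J. length_above cs (m - l' + k))"
            using pre rD by (auto simp: le_diff_conv2 dest: order_trans) (metis (no_types, lifting) Nat.le_diff_conv2 add.assoc add.commute diff_add_assoc2 rD)
          show "sum_list rs' = D + c - r + (\<Sum>k<l'. length_above cs (m - l' + k))"
            using less.prems(9) rD unfolding Suc shift rs x by simp
          show "\<forall>x\<in>set cs. m - l' \<le> x \<and> x \<le> m" using above less.prems(1,7) Suc by fastforce
        qed (use less.prems Suc rs in auto)
        then show ?thesis unfolding Suc rs x using rD by (rule take_row)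
      qed
    qed
  qed
qed

end

text \<open>The necessity half of Gale-Ryser: \<open>J\<close> rows place at most
  \<open>min (col_sum A j) J\<close> ones into column \<open>j\<close>. The sums may be sorted
  because the uniform objective is symmetric in rows and in columns.\<close>

lemma binary_mats_completion:
  assumes A: "A \<in> binary_mats m n"
  shows "\<exists>rs cs. completion m m n n 0 rs cs \<and>
     uniform_objective f g A = sum_list (map f rs) + sum_list (map g cs)"
proof -
  have dim: "dim_row A = m" "dim_col A = n" and bin: "\<And>i j. i < m \<Longrightarrow> j < n \<Longrightarrow> A $$ (i, j) \<le> 1"
    using A by (auto simp: binary_mats_def le_less)
  define ro where "ro = rev (sort_key (row_sum A) [0..<m])"
  define co where "co = rev (sort_key (col_sum A) [0..<n])"
  define rs where "rs = map (row_sum A) ro"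
  define cs where "cs = map (col_sum A) co"
  have ro: "distinct ro" "set ro = {..<m}" "length ro = m" by (auto simp: ro_def)
  have co: "distinct co" "set co = {..<n}" "length co = n" by (auto simp: co_def)
  have srt: "sorted_wrt (\<ge>) rs" "sorted_wrt (\<ge>) cs"
    unfolding rs_def cs_def ro_def co_def rev_map[symmetric] sorted_wrt_rev by simp_all
  have cnt: "length_above cs k = count_above n (col_sum A) k" for k
  proof -
    have "length_above cs k = length (filter (\<lambda>j. k < col_sum A j) co)"
      by (simp add: length_above_def cs_def filter_map o_def)
    also have "\<dots> = card (set (filter (\<lambda>j. k < col_sum A j) co))"
      using co(1) by (simp only: distinct_card distinct_filter)
    also have "\<dots> = count_above n (col_sum A) k"
      using co(2) by (simp add: count_above_def conj_commute)
    finally show ?thesis .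
  qed
  have rle: "row_sum A i \<le> n" if "i < m" for i
    using sum_mono[of "{..<n}" "\<lambda>j. A $$ (i, j)" "\<lambda>_. 1"] bin that by (simp add: row_sum_def dim)
  have cle: "(\<Sum>i\<in>I. A $$ (i, j)) \<le> card I" if "I \<subseteq> {..<m}" "j < n" for I j
    using sum_mono[of I "\<lambda>i. A $$ (i, j)" "\<lambda>_. 1"] bin that by auto
  have cle': "(\<Sum>i\<in>I. A $$ (i, j)) \<le> col_sum A j" if "I \<subseteq> {..<m}" for I j
    unfolding col_sum_def dim using that by (intro sum_mono2) auto
  have pre: "sum_list (take J rs) \<le> (\<Sum>k<J. count_above n (col_sum A) k)" if "J \<le> m" for J
  proof -
    let ?I = "set (take J ro)"
    have I: "?I \<subseteq> {..<m}" "card ?I = J"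
      using ro that set_take_subset[of J ro] by (auto simp: distinct_card)
    have "sum_list (take J rs) = (\<Sum>i\<in>?I. row_sum A i)"
      using ro(1) by (simp add: rs_def take_map sum_list_distinct_conv_sum_set)
    also have "\<dots> = (\<Sum>j<n. \<Sum>i\<in>?I. A $$ (i, j))"
      unfolding row_sum_def dim by (rule sum.swap)
    also have "\<dots> \<le> (\<Sum>j<n. min (col_sum A j) J)"
      using cle[OF I(1)] cle'[OF I(1)] I(2) by (intro sum_mono) simp
    finally show ?thesis by (simp add: sum_count_above)
  qed
  have colle: "col_sum A j \<le> m" if "j < n" for j
    using cle[of "{..<m}" j] that by (simp add: col_sum_def dim)
  have tot: "sum_list rs = (\<Sum>k<m. count_above n (col_sum A) k)"
  proof -
    have "sum_list rs = (\<Sum>i<m. row_sum A i)"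
      using ro by (simp add: rs_def sum_list_distinct_conv_sum_set)
    also have "\<dots> = (\<Sum>j<n. col_sum A j)"
      unfolding row_sum_def col_sum_def dim by (rule sum.swap)
    also have "\<dots> = (\<Sum>j<n. min (col_sum A j) m)" using colle by simp
    finally show ?thesis by (simp add: sum_count_above)
  qed
  have "completion m m n n 0 rs cs"
    using srt pre tot colle rle ro co
    by (intro admissible_completion) (auto simp: cnt, auto simp: rs_def cs_def)
  moreover have "uniform_objective f g A = sum_list (map f rs) + sum_list (map g cs)"
    using ro co by (simp add: uniform_objective_def dim rs_def cs_def sum_list_distinct_conv_sum_set)
  ultimately show ?thesis by blast
qed

lemma completion_gale_ryser:
  assumes "completion m m n n 0 rs cs"
  shows "gale_ryser n rs (\<lambda>j. cs ! j)" "length rs = m" "length cs = n"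
    "\<forall>x\<in>set rs. x \<le> n" "\<forall>x\<in>set cs. x \<le> m"
proof -
  note adm = completion_admissible[OF assms order_refl]
  then show len: "length rs = m" "length cs = n" "\<forall>x\<in>set rs. x \<le> n" and le: "\<forall>x\<in>set cs. x \<le> m" by auto
  have cnt: "length_above cs k = count_above n (\<lambda>j. cs ! j) k" for k
    using len(2) by (simp add: length_above_def length_filter_conv_card count_above_def)
  \<comment> \<open>No column sum exceeds \<open>m\<close>, so the first \<open>m\<close> levels
    contain the whole diagram.\<close>
  have "(\<Sum>k<m. count_above n (\<lambda>j. cs ! j) k) = (\<Sum>j<n. cs ! j)"
    unfolding sum_count_above using le len by (intro sum.cong) (auto simp: min_def)
  then show "gale_ryser n rs (\<lambda>j. cs ! j)"
    using adm by (simp add: gale_ryser_def cnt)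
qed

section \<open>Dynamic programming over the Gale-Ryser inequalities\<close>

text \<open>The tag 0 means that there is no candidate yet and plays the role of an infinite
  value.\<close>

definition improve :: "nat \<Rightarrow> int \<Rightarrow> int \<times> nat \<Rightarrow> int \<times> nat" where
  "improve i t s = (if snd s = 0 \<or> t < fst s then (t, i) else s)"

context
  fixes m :: nat and f g :: "nat \<Rightarrow> int"
begin

text \<open>The second component names the rule of \<open>completion\<close> that attains the minimum: 1 for \<open>lower\<close>,
  2 for \<open>take_col\<close>, 3 for \<open>take_row\<close>, and 0 for \<open>finish\<close>.  The side conditions \<open>D \<le> l * r\<close> exclude
  exactly the states without completion, so no infinite values are needed.\<close>

function best :: "nat \<Rightarrow> nat \<Rightarrow> nat \<Rightarrow> nat \<Rightarrow> int \<times> nat" where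
  "best l r c D =
    (let s1 = (if 0 < r \<and> D \<le> l * (r - 1) then improve 1 (fst (best l (r - 1) c D)) (0, 0) else (0, 0));
         s2 = (if 0 < c then improve 2 (g (m - l) + fst (best l r (c - 1) D)) s1 else s1)
     in if 0 < l \<and> r \<le> D + c \<and> D + c - r \<le> (l - 1) * r
        then improve 3 (f r + fst (best (l - 1) r c (D + c - r))) s2 else s2)"
  by pat_completeness auto
termination by (relation "measure (\<lambda>(l, r, c, D). l + r + c)") auto

declare best.simps [simp del]

lemma best_lower: "0 < r \<Longrightarrow> D \<le> l * (r - 1) \<Longrightarrow> fst (best l r c D) \<le> fst (best l (r - 1) c D)"
  by (subst best.simps) (auto simp: Let_def improve_def)

lemma best_col: "0 < c \<Longrightarrow> fst (best l r c D) \<le> g (m - l) + fst (best l r (c - 1) D)"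
  by (subst best.simps) (auto simp: Let_def improve_def)

lemma best_row: "0 < l \<Longrightarrow> r \<le> D + c \<Longrightarrow> D + c - r \<le> (l - 1) * r \<Longrightarrow>
    fst (best l r c D) \<le> f r + fst (best (l - 1) r c (D + c - r))"
  by (subst best.simps) (auto simp: Let_def improve_def)

lemma best_choice:
  "snd (best l r c D) = 0 \<and> fst (best l r c D) = 0 \<and> c = 0 \<and> \<not> (0 < r \<and> D \<le> l * (r - 1)) \<and>
      \<not> (0 < l \<and> r \<le> D + c \<and> D + c - r \<le> (l - 1) * r) \<or>
   snd (best l r c D) = 1 \<and> 0 < r \<and> D \<le> l * (r - 1) \<and>
      fst (best l r c D) = fst (best l (r - 1) c D) \<or>
   snd (best l r c D) = 2 \<and> 0 < c \<and>
      fst (best l r c D) = g (m - l) + fst (best l r (c - 1) D) \<or>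
   snd (best l r c D) = 3 \<and> 0 < l \<and> r \<le> D + c \<and> D + c - r \<le> (l - 1) * r \<and>
      fst (best l r c D) = f r + fst (best (l - 1) r c (D + c - r))"
proof -
  obtain x y z where xyz: "x = best l (r - 1) c D" "y = best l r (c - 1) D"
    "z = best (l - 1) r c (D + c - r)" by blast
  have "best l r c D =
    (let s1 = (if 0 < r \<and> D \<le> l * (r - 1) then improve 1 (fst x) (0, 0) else (0, 0));
         s2 = (if 0 < c then improve 2 (g (m - l) + fst y) s1 else s1)
     in if 0 < l \<and> r \<le> D + c \<and> D + c - r \<le> (l - 1) * r then improve 3 (f r + fst z) s2 else s2)"
    unfolding xyz by (rule best.simps)
  then show ?thesis
    unfolding xyz[symmetric]
    by (cases "0 < r \<and> D \<le> l * (r - 1)"; cases "0 < c";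
        cases "0 < l \<and> r \<le> D + c \<and> D + c - r \<le> (l - 1) * r")
      (simp_all add: Let_def improve_def)
qed

lemma best_finish: "fst (best 0 r 0 0) = 0"
proof (induction r)
  case 0
  show ?case by (subst best.simps) simp
next
  case (Suc r)
  then show ?case by (subst best.simps) (simp add: Let_def improve_def)
qed

definition cost :: "nat list \<Rightarrow> nat list \<Rightarrow> int" where
  "cost rs cs = sum_list (map f rs) + sum_list (map g cs)"

text \<open>By \<open>completion_slack\<close> the side conditions in \<open>best\<close> hold along
  every completion, so each rule used is among the candidates compared.\<close>

lemma best_le_cost: "completion m l r c D rs cs \<Longrightarrow> fst (best l r c D) \<le> cost rs cs"
proof (induction rule: completion.induct)
  case (finish r)
  then show ?case by (simp add: best_finish cost_def)
next
  case (lower l r c D rs cs)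
  then show ?case using best_lower[of "Suc r" D l c] completion_slack[OF lower.hyps] by simp
next
  case (take_col l r c D rs cs)
  then show ?case using best_col[of "Suc c" l r D] by (simp add: cost_def)
next
  case (take_row l r c D rs cs)
  then show ?case
    using best_row[of "Suc l" r D c] completion_slack[OF take_row.hyps(1)] by (simp add: cost_def)
qed

text \<open>There is no dead end before the goal. If \<open>l > 0\<close> and \<open>c = 0\<close>,
  then \<open>take_row\<close> applies when \<open>r <= D\<close>, and otherwise
  \<open>lower\<close> does, since \<open>D <= r - 1 <= l * (r - 1)\<close>.\<close>

lemma best_choice_0:
  assumes "D \<le> l * r" "snd (best l r c D) = 0"
  shows "l = 0" "c = 0" "D = 0"
proof -
  have *: "c = 0" "\<not> (0 < r \<and> D \<le> l * (r - 1))" "\<not> (0 < l \<and> r \<le> D + c \<and> D + c - r \<le> (l - 1) * r)"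
    using best_choice[of l r c D] assms(2) by auto
  show l: "l = 0"
  proof (rule ccontr)
    assume "l \<noteq> 0"
    then obtain l' where l: "l = Suc l'" by (cases l) auto
    then have "D < r" using * assms(1) by auto
    then obtain r' where r: "r = Suc r'" by (cases r) auto
    then have "D \<le> l * (r - 1)" using \<open>D < r\<close> l by simp
    then show False using * r by simp
  qed
  show "c = 0" using * by simp
  show "D = 0" using assms(1) l by simp
qed

end

section \<open>The program\<close>

abbreviation cell :: "int \<Rightarrow> key" where
  "cell x \<equiv> Digit (Lit x) Root"

abbreviation var :: "int \<Rightarrow> expr" where
  "var x \<equiv> Fetch (cell x)"

abbreviation arr :: "int \<Rightarrow> expr \<Rightarrow> key" where
  "arr a e \<equiv> Digit e (cell a)"

abbreviation table :: "int \<Rightarrow> expr \<Rightarrow> expr \<Rightarrow> expr \<Rightarrow> expr \<Rightarrow> key" where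
  "table a l r c D \<equiv> Digit l (Digit r (Digit c (Digit D (cell a))))"

text \<open>Positivity is the only test, so \<open>x <= y\<close> becomes
  \<open>y - x + 1 > 0\<close> here and below.\<close>

definition read_array :: "int \<Rightarrow> expr \<Rightarrow> prog" where
  "read_array a b = Loop 0 (Cond (Plus (Minus b (var 0)) (Lit 1)) (Input (arr a (var 0))) Nop)"

text \<open>Variables 4 and 5 hold the rule and the value of the running minimum, variable 6 the
  candidate.\<close>

definition improve_prog :: "int \<Rightarrow> expr \<Rightarrow> prog" where
  "improve_prog i e =
     Assign (cell 6) e ;;
     Cond (var 4)
       (Cond (Minus (var 5) (var 6)) (Assign (cell 4) (Lit i) ;; Assign (cell 5) (var 6)) Nop)
       (Assign (cell 4) (Lit i) ;; Assign (cell 5) (var 6))"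

text \<open>Variables 0 to 3 hold \<open>l\<close>, \<open>r\<close>, \<open>c\<close>, \<open>D\<close>; arrays 10 and 11 hold \<open>f\<close> and \<open>g\<close>, tables 12 and
  13 the two components of \<open>best\<close>, arrays 14 and 16 the row and column sums, array 15 a matrix row.\<close>

definition lower_prog :: prog where
  "lower_prog = Cond (var 1)
     (Cond (Plus (Minus (Times (var 0) (Minus (var 1) (Lit 1))) (var 3)) (Lit 1))
       (improve_prog 1 (Fetch (table 12 (var 0) (Minus (var 1) (Lit 1)) (var 2) (var 3)))) Nop) Nop"

definition take_col_prog :: prog where
  "take_col_prog = Cond (var 2)
     (improve_prog 2 (Plus (Fetch (arr 11 (Minus BndM (var 0))))
       (Fetch (table 12 (var 0) (var 1) (Minus (var 2) (Lit 1)) (var 3))))) Nop"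

definition take_row_prog :: prog where
  "take_row_prog = Cond (var 0)
     (Cond (Plus (Minus (Plus (var 3) (var 2)) (var 1)) (Lit 1))
       (Cond (Plus (Minus (Times (Minus (var 0) (Lit 1)) (var 1))
           (Minus (Plus (var 3) (var 2)) (var 1))) (Lit 1))
         (improve_prog 3 (Plus (Fetch (arr 10 (var 1)))
           (Fetch (table 12 (Minus (var 0) (Lit 1)) (var 1) (var 2)
             (Minus (Plus (var 3) (var 2)) (var 1)))))) Nop) Nop) Nop"

definition best_prog :: prog where
  "best_prog =
     Assign (cell 4) (Lit 0) ;; Assign (cell 5) (Lit 0) ;;
     lower_prog ;; take_col_prog ;; take_row_prog ;;
     Assign (table 12 (var 0) (var 1) (var 2) (var 3)) (var 5) ;;
     Assign (table 13 (var 0) (var 1) (var 2) (var 3)) (var 4)"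

text \<open>Each rule refers to a smaller \<open>l\<close>, to the same \<open>l\<close> and a
  smaller \<open>r\<close>, or to the same \<open>l\<close>, \<open>r\<close> and a smaller
  \<open>c\<close>; so the lexicographic order works, with the slack in any order.\<close>

definition tables_prog :: prog where
  "tables_prog = Loop 0 (Loop 1 (Loop 2 (Loop 3 best_prog)))"

text \<open>The tag is recognised by testing it against 2, 1 and 0. Tag 0 changes nothing but
  variable 4, so surplus rounds are harmless. Column sums appear in ascending order and are stored
  from the right end.\<close>

definition walk_step_prog :: prog where
  "walk_step_prog =
     Assign (cell 4) (Fetch (table 13 (var 0) (var 1) (var 2) (var 3))) ;;
     Cond (Minus (var 4) (Lit 2))
       (Assign (arr 14 (Minus BndM (var 0))) (var 1) ;;
        Assign (cell 3) (Minus (Plus (var 3) (var 2)) (var 1)) ;;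
        Assign (cell 0) (Minus (var 0) (Lit 1)))
       (Cond (Minus (var 4) (Lit 1))
         (Assign (cell 2) (Minus (var 2) (Lit 1)) ;;
          Assign (arr 16 (var 2)) (Minus BndM (var 0)))
         (Cond (var 4) (Assign (cell 1) (Minus (var 1) (Lit 1))) Nop))"

definition walk_prog :: prog where
  "walk_prog =
     Assign (cell 0) BndM ;; Assign (cell 1) BndN ;; Assign (cell 2) BndN ;;
     Assign (cell 3) (Lit 0) ;; Loop 7 walk_step_prog"

text \<open>Variable 6 counts the ones still to be placed in row \<open>i\<close> (variable 0); the sweep visits the
  columns \<open>j\<close> (variable 8) by descending remaining sum \<open>m - v\<close> (\<open>v\<close> in variable 7).\<close>

definition select_prog :: prog where
  "select_prog = Loop 7 (Loop 8
     (Cond (Minus BndN (var 8))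
       (Cond (Fetch (arr 15 (var 8))) Nop
         (Cond (var 6)
           (Cond (Plus (Minus (Fetch (arr 16 (var 8))) (Minus BndM (var 7))) (Lit 1))
             (Assign (arr 15 (var 8)) (Lit 1) ;; Assign (cell 6) (Minus (var 6) (Lit 1)))
             Nop) Nop)) Nop))"

definition emit_prog :: prog where
  "emit_prog = Loop 8
     (Cond (Minus BndN (var 8))
       (Output (Fetch (arr 15 (var 8))) ;;
        Assign (arr 16 (var 8)) (Minus (Fetch (arr 16 (var 8))) (Fetch (arr 15 (var 8)))) ;;
        Assign (arr 15 (var 8)) (Lit 0)) Nop)"

definition matrix_prog :: prog where
  "matrix_prog = Loop 0
     (Cond (Minus BndM (var 0))
       (Assign (cell 6) (Fetch (arr 14 (var 0))) ;; select_prog ;; emit_prog) Nop)"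

definition line_sum_prog :: prog where
  "line_sum_prog = read_array 10 BndN ;; read_array 11 BndM ;; tables_prog ;; walk_prog ;; matrix_prog"

text \<open>\<open>C\<close> is the set of columns considered so far and \<open>S\<close> the part
  chosen: everything considered, until \<open>r\<close> columns are reached.\<close>

definition selection :: "nat \<Rightarrow> (nat \<Rightarrow> nat) \<Rightarrow> nat set \<Rightarrow> nat \<Rightarrow> nat set \<Rightarrow> bool" where
  "selection n cl C r S \<longleftrightarrow> S \<subseteq> C \<and> finite S \<and> card S \<le> r \<and> (card S = r \<or> S = C) \<and>
     (\<forall>x\<in>S. \<forall>y<n. y \<notin> S \<longrightarrow> cl y \<le> cl x)"

lemma selection_skip:
  assumes "selection n cl C r S" "card S = r \<or> j \<in> S \<or> C' = C" "C \<subseteq> C'" "C' \<subseteq> insert j C"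
  shows "selection n cl C' r S"
  using assms unfolding selection_def by blast

lemma selection_insert:
  assumes "selection n cl C r S" "card S < r" "j \<notin> S"
    and "\<And>y. y < n \<Longrightarrow> y \<notin> insert j C \<Longrightarrow> cl y \<le> cl j"
  shows "selection n cl (insert j C) r (insert j S)"
proof -
  have "S = C" "finite S" using assms(1,2) by (auto simp: selection_def)
  then show ?thesis using assms by (auto simp: selection_def)
qed

section \<open>Verification of the program\<close>

context
  fixes q m n :: nat and f g :: "nat \<Rightarrow> int"
begin

definition inputs :: "store \<Rightarrow> bool" where
  "inputs mem \<longleftrightarrow> (\<forall>i\<le>n. mem [i, 10] = f i) \<and> (\<forall>i\<le>m. mem [i, 11] = g i) \<and> (\<forall>j<n. mem [j, 15] = 0)"

text \<open>\<open>P\<close> marks the states whose table entries are already computed.\<close>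

definition filled :: "(nat \<Rightarrow> nat \<Rightarrow> nat \<Rightarrow> nat \<Rightarrow> bool) \<Rightarrow> store \<Rightarrow> bool" where
  "filled P mem \<longleftrightarrow> (\<forall>l\<le>m. \<forall>r\<le>n. \<forall>c\<le>n. \<forall>D<q. P l r c D \<longrightarrow>
     mem [l, r, c, D, 12] = fst (best m f g l r c D) \<and>
     mem [l, r, c, D, 13] = int (snd (best m f g l r c D)))"

lemma filledD:
  assumes "filled P mem" "P l r c D" "l \<le> m" "r \<le> n" "c \<le> n" "D < q"
  shows "mem [l, r, c, D, 12] = fst (best m f g l r c D)"
    "mem [l, r, c, D, 13] = int (snd (best m f g l r c D))"
  using assms by (auto simp: filled_def)

lemma filled_mono:
  assumes "filled P mem"
    "\<And>l r c D. l \<le> m \<Longrightarrow> r \<le> n \<Longrightarrow> c \<le> n \<Longrightarrow> D < q \<Longrightarrow> Q l r c D \<Longrightarrow> P l r c D"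
  shows "filled Q mem"
  using assms unfolding filled_def by blast

lemma inputs_var [simp]: "inputs (mem([i] := v)) = inputs mem"
  by (simp add: inputs_def)

lemma filled_var [simp]: "filled P (mem([i] := v)) = filled P mem"
  by (simp add: filled_def)

definition optimal :: "nat list \<Rightarrow> nat list \<Rightarrow> bool" where
  "optimal rs cs \<longleftrightarrow> completion m m n n 0 rs cs \<and> cost f g rs cs = fst (best m f g m n n 0)"

text \<open>\<open>rs0\<close> and \<open>cs0\<close> are the sums fixed so far. The last conjunct
  is a promise: any completion of the current state that attains \<open>best\<close> yields an
  optimal whole. That one exists is seen only at the end, when \<open>finish\<close> supplies
  it.\<close>

definition walk_inv :: "nat \<Rightarrow> store \<Rightarrow> bool" where
  "walk_inv t mem \<longleftrightarrow> (\<exists>l r c D rs0 cs0. l \<le> m \<and> r \<le> n \<and> c \<le> n \<and> D \<le> l * r \<and>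
     mem [0] = int l \<and> mem [1] = int r \<and> mem [2] = int c \<and> mem [3] = int D \<and>
     filled (\<lambda>_ _ _ _. True) mem \<and> (\<forall>j<n. mem [j, 15] = 0) \<and>
     (l + r + c + t \<le> m + n + n \<or> snd (best m f g l r c D) = 0) \<and>
     length rs0 = m - l \<and> (\<forall>i<m - l. mem [i, 14] = int (rs0 ! i)) \<and>
     length cs0 = n - c \<and> (\<forall>j<n - c. mem [c + j, 16] = int (cs0 ! j)) \<and>
     (\<forall>rs cs. completion m l r c D rs cs \<longrightarrow> cost f g rs cs = fst (best m f g l r c D) \<longrightarrow>
       optimal (rs0 @ rs) (cs @ cs0)))"

context
  assumes q: "(m + 16) * (n + 16) \<le> q"
begin

lemma q_bound: "m * n + 16 * m + 16 * n + 256 \<le> q"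
  using q by (simp add: algebra_simps)

text \<open>With \<open>D <= l * r\<close> this makes every relevant slack a valid digit of a table
  key.\<close>

lemma prod_less: "a \<le> m \<Longrightarrow> b \<le> n \<Longrightarrow> a * b < q"
  using mult_le_mono[of a m b n] q_bound by linarith

lemma clip_int [simp]: "t < q \<Longrightarrow> clip q (int t) = t"
  by (simp add: clip_def)

lemma clip_numeral [simp]: "(numeral k :: int) \<le> 16 \<Longrightarrow> clip q (numeral k) = numeral k"
proof -
  assume "(numeral k :: int) \<le> 16"
  then have "(numeral k :: int) < int q" using q_bound by linarith
  then show ?thesis by (simp add: clip_def)
qed

lemma clip_0_1 [simp]: "clip q 0 = 0" "clip q 1 = 1"
  using q_bound by (simp_all add: clip_def)

lemma wp_read_array:
  assumes a: "1 \<le> a" "a \<le> 16" and b: "\<And>mem. eval q m n b mem = int N" "N < q"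
    and post: "\<And>mem'. (\<forall>i\<le>N. mem' [i, nat a] = h i) \<Longrightarrow>
      (\<forall>k. k \<noteq> [0] \<longrightarrow> (\<forall>i. k \<noteq> [i, nat a]) \<longrightarrow> mem' k = mem k) \<Longrightarrow> P mem' xs ys"
  shows "wp q m n (read_array a b) P mem (map h [0..<N + 1] @ xs) ys"
  unfolding read_array_def
proof (rule wp_Loop[where I = "\<lambda>t mem' xs' ys'. (\<forall>i. i < t \<longrightarrow> i \<le> N \<longrightarrow> mem' [i, nat a] = h i) \<and>
      (\<forall>k. k \<noteq> [0] \<longrightarrow> (\<forall>i. k \<noteq> [i, nat a]) \<longrightarrow> mem' k = mem k) \<and>
      xs' = map h [t..<N + 1] @ xs \<and> ys' = ys"], goal_cases)
  case (2 t mem' xs' ys')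
  have a': "clip q a = nat a" using a q_bound by (simp add: clip_def)
  show ?case
  proof (cases "t \<le> N")
    case True
    then have "[t..<N + 1] = t # [Suc t..<N + 1]" by (simp add: upt_conv_Cons del: upt_Suc)
    then show ?thesis using 2 True by (auto simp: b a' less_Suc_eq simp del: upt_Suc)
  next
    case False
    then show ?thesis using 2 by (auto simp: b a')
  qed
next
  case (3 mem' xs' ys')
  then show ?case using post[of mem'] b(2) by auto
qed auto

lemma wp_improve:
  assumes "mem [4] = int (snd s)" "mem [5] = fst s" "1 \<le> i" "t = eval q m n e mem"
    and "P (mem([6] := t, [4] := int (snd (improve i t s)), [5] := fst (improve i t s))) xs ys"
  shows "wp q m n (improve_prog (int i) e) P mem xs ys"
proof -
  have 1: "(mem([6] := t)) = mem([6] := t, [4] := int (snd s), [5] := fst s)"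
    using assms(1,2) by (auto simp: fun_eq_iff)
  show ?thesis
  proof (cases "snd s = 0 \<or> t < fst s")
    case True
    then show ?thesis using assms(1-4) assms(5)[unfolded improve_def if_P[OF True]]
      by (auto simp: improve_prog_def)
  next
    case False
    then have "P (mem([6] := t)) xs ys" using assms(5) by (subst 1) (simp add: improve_def)
    then show ?thesis using assms(1-4) False by (simp add: improve_prog_def)
  qed
qed

text \<open>The loops also visit states out of range, about whose table entries nothing is known;
  there the program merely has to go on, with arbitrary \<open>x\<close> and
  \<open>y\<close>.\<close>

lemma wp_best:
  assumes vars: "mem [0] = int l" "mem [Suc 0] = int r" "mem [2] = int c" "mem [3] = int D"
    and less: "l < q" "r < q" "c < q" "D < q"
    and f: "\<And>i. i \<le> n \<Longrightarrow> mem [i, 10] = f i" and g: "\<And>i. i \<le> m \<Longrightarrow> mem [i, 11] = g i"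
    and low: "l \<le> m \<Longrightarrow> r \<le> n \<Longrightarrow> c \<le> n \<Longrightarrow> 0 < r \<Longrightarrow>
      mem [l, r - 1, c, D, 12] = fst (best m f g l (r - 1) c D)"
    and col: "l \<le> m \<Longrightarrow> r \<le> n \<Longrightarrow> c \<le> n \<Longrightarrow> 0 < c \<Longrightarrow>
      mem [l, r, c - 1, D, 12] = fst (best m f g l r (c - 1) D)"
    and row: "l \<le> m \<Longrightarrow> r \<le> n \<Longrightarrow> c \<le> n \<Longrightarrow> 0 < l \<Longrightarrow> r \<le> D + c \<Longrightarrow> D + c - r < q \<Longrightarrow>
      mem [l - 1, r, c, D + c - r, 12] = fst (best m f g (l - 1) r c (D + c - r))"
    and post: "\<And>u v w x y. (l \<le> m \<Longrightarrow> r \<le> n \<Longrightarrow> c \<le> n \<Longrightarrow>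
        x = fst (best m f g l r c D) \<and> y = int (snd (best m f g l r c D))) \<Longrightarrow>
      P (mem([4] := u, [5] := v, [6] := w, [l, r, c, D, 12] := x, [l, r, c, D, 13] := y)) xs ys"
  shows "wp q m n best_prog P mem xs ys"
proof -
  \<comment> \<open>\<open>M s u\<close> is the store in the course of the computation, with running
    minimum \<open>s\<close> and last candidate \<open>u\<close>.\<close>
  define M where "M = (\<lambda>s u. mem([4] := int (snd s), [5] := fst s, [6] := u :: int))"
  have M: "M s u [0] = int l" "M s u [Suc 0] = int r" "M s u [2] = int c" "M s u [3] = int D"
    "M s u [4] = int (snd s)" "M s u [5] = fst s" "M s u [6] = u" "M s u (i # j # k) = mem (i # j # k)"
    for s u i j k using vars by (simp_all add: M_def)
  have improve: "wp q m n (improve_prog (int i) e) R (M s u) xs ys"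
    if "eval q m n e (M s u) = t" "1 \<le> i" "R (M (improve i t s) t) xs ys" for i e R s u t
  proof (rule wp_improve[of _ s _ t])
    have "(M s u)([6] := t, [4] := int (snd (improve i t s)), [5] := fst (improve i t s)) = M (improve i t s) t"
      by (auto simp: M_def fun_eq_iff)
    then show "R ((M s u)([6] := t, [4] := int (snd (improve i t s)), [5] := fst (improve i t s))) xs ys"
      using that(3) by simp
  qed (use that(1,2) M in auto)
  let ?c1 = "0 < r \<and> D \<le> l * (r - 1)"
  let ?c3 = "0 < l \<and> r \<le> D + c \<and> D + c - r \<le> (l - 1) * r"
  \<comment> \<open>\<open>x\<close>, \<open>y\<close>, \<open>z\<close> are the candidates as the
    program computes them, clipped indices included. Control flow can thus be followed for every
    state, and only states in range are compared with \<open>best\<close>.\<close>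
  define x where "x = mem [l, clip q (int r - 1), c, D, 12]"
  define y where "y = mem [clip q (int m - int l), 11] + mem [l, r, clip q (int c - 1), D, 12]"
  define z where "z = mem [r, 10] + mem [clip q (int l - 1), r, c, clip q (int D + int c - int r), 12]"
  define s1 where "s1 = (if ?c1 then improve 1 x (0, 0) else (0, 0))"
  define s2 where "s2 = (if 0 < c then improve 2 y s1 else s1)"
  define s3 where "s3 = (if ?c3 then improve 3 z s2 else s2)"
  have s3: "s3 = best m f g l r c D" if "l \<le> m" "r \<le> n" "c \<le> n"
  proof -
    have "int m - int l = int (m - l)" "m - l < q" using that(1) q_bound by auto
    then have cm: "clip q (int m - int l) = m - l" by (simp only: clip_int)
    have "x = fst (best m f g l (r - 1) c D)" if ?c1
    proof -
      have "int r - 1 = int (r - 1)" using that by simp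
      then have "clip q (int r - 1) = r - 1" using less by (simp only: clip_int)
      then show ?thesis using low that \<open>l \<le> m\<close> \<open>r \<le> n\<close> \<open>c \<le> n\<close> by (simp add: x_def)
    qed
    moreover have "y = g (m - l) + fst (best m f g l r (c - 1) D)" if "0 < c"
    proof -
      have "int c - 1 = int (c - 1)" using that by simp
      then have "clip q (int c - 1) = c - 1" using less by (simp only: clip_int)
      then show ?thesis using col that \<open>l \<le> m\<close> \<open>r \<le> n\<close> \<open>c \<le> n\<close> g[of "m - l"]
        by (simp add: y_def cm)
    qed
    moreover have "z = f r + fst (best m f g (l - 1) r c (D + c - r))" if ?c3
    proof -
      have "int l - 1 = int (l - 1)" using that by simp
      then have 1: "clip q (int l - 1) = l - 1" using less by (simp only: clip_int)
      have "(l - 1) * r < q" using \<open>l \<le> m\<close> \<open>r \<le> n\<close> by (intro prod_less) auto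
      then have 2: "D + c - r < q" using that by linarith
      have "int D + int c - int r = int (D + c - r)" using that by simp
      then have "clip q (int D + int c - int r) = D + c - r" using 2 by (simp only: clip_int)
      then show ?thesis using row that \<open>l \<le> m\<close> \<open>r \<le> n\<close> \<open>c \<le> n\<close> f[of r] 1 2
        by (simp add: z_def)
    qed
    ultimately show ?thesis
      unfolding s3_def s2_def s1_def by (subst best.simps) (simp add: Let_def)
  qed
  define S where "S = Assign (table 12 (var 0) (var 1) (var 2) (var 3)) (var 5) ;;
     Assign (table 13 (var 0) (var 1) (var 2) (var 3)) (var 4)"
  have W4: "wp q m n S P (M s3 u) xs ys" for u
  proof -
    have "P (mem([4] := int (snd s3), [5] := fst s3, [6] := u, [l, r, c, D, 12] := fst s3,
        [l, r, c, D, 13] := int (snd s3))) xs ys"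
      by (rule post) (use s3 in auto)
    then show ?thesis by (simp add: S_def M less) (simp add: M_def)
  qed
  have cond1: "0 < int l * (int r - 1) - int D + 1 \<longleftrightarrow> D \<le> l * (r - 1)" if "0 < r"
  proof -
    have "int l * (int r - 1) = int (l * (r - 1))" using that by simp
    then show ?thesis by linarith
  qed
  have cond3: "0 < int (clip q (int l - 1)) * int r - (int D + int c - int r) + 1 \<longleftrightarrow> D + c - r \<le> (l - 1) * r"
    if "0 < l" "r \<le> D + c"
  proof -
    have "int l - 1 = int (l - 1)" using that by simp
    then have "clip q (int l - 1) = l - 1" using less by (simp only: clip_int)
    then have 1: "int (clip q (int l - 1)) * int r = int ((l - 1) * r)" by simp
    show ?thesis unfolding 1 using that by linarith
  qed
  have W3: "wp q m n (take_row_prog ;; S) P (M s2 u) xs ys" for u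
  proof (cases ?c3)
    case True
    have "wp q m n (improve_prog (int 3) (Plus (Fetch (arr 10 (var 1)))
           (Fetch (table 12 (Minus (var 0) (Lit 1)) (var 1) (var 2)
             (Minus (Plus (var 3) (var 2)) (var 1)))))) (wp q m n S P) (M s2 u) xs ys"
      using W4[of z] True by (intro improve[where t = z]) (simp_all add: M less z_def s3_def)
    then show ?thesis using True cond3 by (simp add: take_row_prog_def M)
  next
    case False
    then have "s3 = s2" unfolding s3_def by (rule if_not_P)
    moreover have "r \<le> D + c" if "0 < int D + int c - int r + 1" using that by linarith
    ultimately show ?thesis using False W4[of u] cond3 by (auto simp add: take_row_prog_def M)
  qed
  have W2: "wp q m n (take_col_prog ;; take_row_prog ;; S) P (M s1 u) xs ys" for u
  proof (cases "0 < c")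
    case True
    have "wp q m n (improve_prog (int 2) (Plus (Fetch (arr 11 (Minus BndM (var 0))))
       (Fetch (table 12 (var 0) (var 1) (Minus (var 2) (Lit 1)) (var 3)))))
       (wp q m n (take_row_prog ;; S) P) (M s1 u) xs ys"
      using W3[of y] True by (intro improve[where t = y]) (simp_all add: M less y_def s2_def)
    then show ?thesis using True by (simp add: take_col_prog_def M)
  next
    case False
    then have "s2 = s1" by (simp add: s2_def)
    then show ?thesis using False W3[of u] by (simp add: take_col_prog_def M)
  qed
  have W1: "wp q m n (lower_prog ;; take_col_prog ;; take_row_prog ;; S) P (M (0, 0) u) xs ys" for u
  proof (cases ?c1)
    case True
    have "wp q m n (improve_prog (int 1) (Fetch (table 12 (var 0) (Minus (var 1) (Lit 1)) (var 2) (var 3))))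
       (wp q m n (take_col_prog ;; take_row_prog ;; S) P) (M (0, 0) u) xs ys"
      using W2[of x] True by (intro improve[where t = x]) (simp_all add: M less x_def s1_def)
    then show ?thesis using True cond1 by (simp add: lower_prog_def M less)
  next
    case False
    then have "s1 = (0, 0)" unfolding s1_def by (rule if_not_P)
    then show ?thesis using False W2[of u] cond1 by (auto simp add: lower_prog_def M less)
  qed
  have "mem([4] := 0, [5] := 0) = M (0, 0) (mem [6])" by (auto simp: M_def fun_eq_iff)
  then show ?thesis using W1[of "mem [6]"] by (simp add: best_prog_def S_def[symmetric])
qed

lemma m_less_q: "m < q" and n_less_q: "n < q"
  using q_bound by simp_all

lemma wp_tables:
  assumes init: "inputs mem"
    and post: "\<And>mem'. inputs mem' \<Longrightarrow> filled (\<lambda>_ _ _ _. True) mem' \<Longrightarrow> P mem' xs ys"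
  shows "wp q m n tables_prog P mem xs ys"
  unfolding tables_prog_def
proof (rule wp_Loop[where I = "\<lambda>t mem' xs' ys'. inputs mem' \<and> filled (\<lambda>l r c D. l < t) mem' \<and>
    xs' = xs \<and> ys' = ys"], goal_cases)
  case 1
  then show ?case using init by (simp add: filled_def)
next
  case (3 mem' xs' ys')
  \<comment> \<open>As \<open>m\<close> and \<open>n\<close> are below \<open>q\<close>, the
    \<open>q\<close> rounds of a loop exhaust its index range; the inner loops end in the same
    way.\<close>
  have "filled (\<lambda>l r c D. l < q) mem'" using 3 by simp
  then have "filled (\<lambda>_ _ _ _. True) mem'"
    by (rule filled_mono) (use m_less_q n_less_q in auto)
  then show ?case using 3 post by blast
next
  case (2 l mem1 xs1 ys1)
  show ?case
  proof (rule wp_Loop[where I = "\<lambda>t mem' xs' ys'. inputs mem' \<and>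
      filled (\<lambda>l' r' c' D'. l' < l \<or> l' = l \<and> r' < t) mem' \<and> mem' [0] = int l \<and>
      xs' = xs \<and> ys' = ys"], goal_cases)
    case 1
    then show ?case using 2 by (simp)
  next
    case (3 mem' xs' ys')
    have "filled (\<lambda>l' r' c' D'. l' < l \<or> l' = l \<and> r' < q) mem'" using 3 by simp
    then have "filled (\<lambda>l' r' c' D'. l' < Suc l) mem'"
      by (rule filled_mono) (use m_less_q n_less_q in auto)
    then show ?case using 3 by simp
  next
    case (2 r mem2 xs2 ys2)
    show ?case
    proof (rule wp_Loop[where I = "\<lambda>t mem' xs' ys'. inputs mem' \<and>
        filled (\<lambda>l' r' c' D'. l' < l \<or> l' = l \<and> (r' < r \<or> r' = r \<and> c' < t)) mem' \<and>
        mem' [0] = int l \<and> mem' [1] = int r \<and> xs' = xs \<and> ys' = ys"], goal_cases)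
      case 1
      then show ?case using 2 by (simp)
    next
      case (3 mem' xs' ys')
      have "filled (\<lambda>l' r' c' D'. l' < l \<or> l' = l \<and> (r' < r \<or> r' = r \<and> c' < q)) mem'" using 3 by simp
      then have "filled (\<lambda>l' r' c' D'. l' < l \<or> l' = l \<and> r' < Suc r) mem'"
        by (rule filled_mono) (use m_less_q n_less_q in auto)
      then show ?case using 3 by simp
    next
      case (2 c mem3 xs3 ys3)
      show ?case
      proof (rule wp_Loop[where I = "\<lambda>t mem' xs' ys'. inputs mem' \<and>
          filled (\<lambda>l' r' c' D'. l' < l \<or> l' = l \<and> (r' < r \<or> r' = r \<and> (c' < c \<or> c' = c \<and> D' < t))) mem' \<and>
          mem' [0] = int l \<and> mem' [1] = int r \<and> mem' [2] = int c \<and> xs' = xs \<and> ys' = ys"], goal_cases)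
        case 1
        then show ?case using 2 by (simp)
      next
        case (3 mem' xs' ys')
        have "filled (\<lambda>l' r' c' D'. l' < l \<or> l' = l \<and> (r' < r \<or> r' = r \<and> (c' < c \<or> c' = c \<and> D' < q))) mem'" using 3 by simp
        then have "filled (\<lambda>l' r' c' D'. l' < l \<or> l' = l \<and> (r' < r \<or> r' = r \<and> c' < Suc c)) mem'"
          by (rule filled_mono) (use m_less_q n_less_q in auto)
        then show ?case using 3 by simp
      next
        case (2 D mem4 xs4 ys4)
        let ?F = "\<lambda>l' r' c' D'. l' < l \<or> l' = l \<and> (r' < r \<or> r' = r \<and> (c' < c \<or> c' = c \<and> D' < D))"
        have fill: "filled ?F mem4" and inp: "inputs mem4" and eq: "xs4 = xs" "ys4 = ys"
          and v: "mem4 [0] = int l" "mem4 [1] = int r" "mem4 [2] = int c"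
          using 2 by auto
        let ?mem = "mem4([3] := int D)"
        have fill': "filled ?F ?mem" using fill by simp
        note lt = \<open>l < q\<close> \<open>r < q\<close> \<open>c < q\<close> \<open>D < q\<close>
        have "wp q m n best_prog (\<lambda>mem' xs' ys'. inputs mem' \<and>
          filled (\<lambda>l' r' c' D'. l' < l \<or> l' = l \<and> (r' < r \<or> r' = r \<and> (c' < c \<or> c' = c \<and> D' < Suc D))) mem' \<and>
          mem' [0] = int l \<and> mem' [1] = int r \<and> mem' [2] = int c \<and> xs' = xs \<and> ys' = ys)
          ?mem xs4 ys4"
        proof (rule wp_best[where l = l and r = r and c = c and D = D], goal_cases)
          case (9 i)
          then show ?case using inp by (simp add: inputs_def)
        next
          case (10 i)
          then show ?case using inp by (simp add: inputs_def)
        next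
          case 11
          then show ?case using lt by (intro filledD[OF fill']) auto
        next
          case 12
          then show ?case using lt by (intro filledD[OF fill']) auto
        next
          case 13
          then show ?case using lt by (intro filledD[OF fill']) auto
        next
          case (14 u v w x y)
          let ?mem' = "?mem([4] := u, [5] := v, [6] := w, [l, r, c, D, 12] := x, [l, r, c, D, 13] := y)"
          have "inputs ?mem'" using inp by (simp add: inputs_def)
          moreover have "filled (\<lambda>l' r' c' D'. l' < l \<or> l' = l \<and> (r' < r \<or> r' = r \<and> (c' < c \<or> c' = c \<and> D' < Suc D))) ?mem'"
            using fill 14 unfolding filled_def by (auto simp: less_Suc_eq)
          ultimately show ?case using \<open>mem4 [0] = int l\<close> \<open>mem4 [1] = int r\<close> \<open>mem4 [2] = int c\<close> eq by simp
        qed (use v lt in auto)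
        then show ?case by (simp)
      qed
    qed
  qed
qed

text \<open>A completion of the next state, extended by the rule just taken, is one of the current
  state at the cost recorded in \<open>best\<close>; so the promise in \<open>walk_inv\<close> is
  handed on.\<close>

lemma wp_walk_step:
  assumes inv: "walk_inv t mem"
    and post: "\<And>mem'. walk_inv (Suc t) mem' \<Longrightarrow> P mem' xs ys"
  shows "wp q m n walk_step_prog P (mem([7] := int t)) xs ys"
proof -
  obtain l r c D rs0 cs0 where le: "l \<le> m" "r \<le> n" "c \<le> n" "D \<le> l * r"
    and v: "mem [0] = int l" "mem [1] = int r" "mem [2] = int c" "mem [3] = int D"
    and fill: "filled (\<lambda>_ _ _ _. True) mem" and zero: "\<forall>j<n. mem [j, 15] = 0"
    and t: "l + r + c + t \<le> m + n + n \<or> snd (best m f g l r c D) = 0"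
    and rs0: "length rs0 = m - l" "\<forall>i<m - l. mem [i, 14] = int (rs0 ! i)"
    and cs0: "length cs0 = n - c" "\<forall>j<n - c. mem [c + j, 16] = int (cs0 ! j)"
    and opt: "\<And>rs cs. completion m l r c D rs cs \<Longrightarrow> cost f g rs cs = fst (best m f g l r c D) \<Longrightarrow>
       optimal (rs0 @ rs) (cs @ cs0)"
    using inv unfolding walk_inv_def by blast
  have lt: "l < q" "r < q" "c < q" "D < q"
    using le prod_less[OF le(1,2)] q_bound by auto
  define b where "b = best m f g l r c D"
  have tab: "mem [l, r, c, D, 13] = int (snd b)"
    unfolding b_def using lt le by (intro filledD[OF fill]) auto
  have ml: "int m - int l = int (m - l)" "m - l < q" using le q_bound by auto
  have cml: "clip q (int m - int l) = m - l" unfolding ml using ml(2) by (simp only: clip_int)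
  have rt: "int D + int c - int r = int (D + c - r)" if "r \<le> D + c" using that by simp
  let ?mem = "mem([7] := int t, [4] := int (snd b))"
  consider "snd b = 0"
    | "snd b = 1" "0 < r" "D \<le> l * (r - 1)" "fst b = fst (best m f g l (r - 1) c D)"
    | "snd b = 2" "0 < c" "fst b = g (m - l) + fst (best m f g l r (c - 1) D)"
    | "snd b = 3" "0 < l" "r \<le> D + c" "D + c - r \<le> (l - 1) * r"
      "fst b = f r + fst (best m f g (l - 1) r c (D + c - r))"
    using best_choice[where m = m and f = f and g = g and l = l and r = r and c = c and D = D]
    unfolding b_def by (elim disjE conjE; simp)
  then show ?thesis
  proof cases
    case 1
    have "walk_inv (Suc t) ?mem"
      unfolding walk_inv_def
      by (rule exI[of _ l], rule exI[of _ r], rule exI[of _ c], rule exI[of _ D], rule exI[of _ rs0], rule exI[of _ cs0])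
        (use le v fill zero 1 rs0 cs0 opt in \<open>simp add: b_def\<close>)
    from post[OF this] show ?thesis using 1 v tab lt by (simp add: walk_step_prog_def)
  next
    case 2
    let ?mem' = "?mem([1] := int (r - 1))"
    have "walk_inv (Suc t) ?mem'"
      unfolding walk_inv_def
    proof (rule exI[of _ l], rule exI[of _ "r - 1"], rule exI[of _ c], rule exI[of _ D],
        rule exI[of _ rs0], rule exI[of _ cs0], intro conjI allI impI)
      fix rs cs
      assume "completion m l (r - 1) c D rs cs" "cost f g rs cs = fst (best m f g l (r - 1) c D)"
      then show "optimal (rs0 @ rs) (cs @ cs0)"
        using completion.lower[of m l "r - 1" c D rs cs] 2 by (intro opt) (auto simp: b_def)
    qed (use le v fill zero 2 rs0 cs0 t in \<open>auto simp: b_def\<close>)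
    moreover have "int r - 1 = int (r - 1)" using 2 by simp
    ultimately show ?thesis using post[of ?mem'] 2 v tab lt
      by (simp add: walk_step_prog_def del: of_nat_diff)
  next
    case 3
    let ?mem' = "?mem([2] := int (c - 1), [c - 1, 16] := int (m - l))"
    have "walk_inv (Suc t) ?mem'"
      unfolding walk_inv_def
    proof (rule exI[of _ l], rule exI[of _ r], rule exI[of _ "c - 1"], rule exI[of _ D],
        rule exI[of _ rs0], rule exI[of _ "(m - l) # cs0"], intro conjI allI impI)
      fix rs cs
      assume "completion m l r (c - 1) D rs cs" "cost f g rs cs = fst (best m f g l r (c - 1) D)"
      then have "optimal (rs0 @ rs) ((cs @ [m - l]) @ cs0)"
        using completion.take_col[of m l r "c - 1" D rs cs] 3 by (intro opt) (auto simp: b_def cost_def)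
      then show "optimal (rs0 @ rs) (cs @ (m - l) # cs0)" by simp
    next
      fix j assume "j < n - (c - 1)"
      then show "?mem' [c - 1 + j, 16] = int (((m - l) # cs0) ! j)"
        using cs0(2) 3(2) by (cases j) auto
    qed (use le v fill zero 3 rs0 cs0 t in \<open>auto simp: b_def filled_def\<close>)
    moreover have "int c - 1 = int (c - 1)" using 3 by simp
    moreover have "c - 1 < q" using lt by simp
    ultimately show ?thesis using post[of ?mem'] 3 v tab lt ml
      by (simp add: walk_step_prog_def del: of_nat_diff)
  next
    case 4
    let ?mem' = "?mem([m - l, 14] := int r, [3] := int (D + c - r), [0] := int (l - 1))"
    have "walk_inv (Suc t) ?mem'"
      unfolding walk_inv_def
    proof (rule exI[of _ "l - 1"], rule exI[of _ r], rule exI[of _ c], rule exI[of _ "D + c - r"],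
        rule exI[of _ "rs0 @ [r]"], rule exI[of _ cs0], intro conjI allI impI)
      fix rs cs
      assume "completion m (l - 1) r c (D + c - r) rs cs"
        "cost f g rs cs = fst (best m f g (l - 1) r c (D + c - r))"
      then have "optimal (rs0 @ r # rs) (cs @ cs0)"
        using completion.take_row[of m "l - 1" r c D rs cs] 4 by (intro opt) (auto simp: b_def cost_def)
      then show "optimal ((rs0 @ [r]) @ rs) (cs @ cs0)" by simp
    next
      fix i assume "i < m - (l - 1)"
      then show "?mem' [i, 14] = int ((rs0 @ [r]) ! i)"
        using rs0 4(2) le(1) by (cases "i < m - l") (auto simp: nth_append)
    qed (use le v fill zero 4 rs0 cs0 t in \<open>auto simp: b_def filled_def\<close>)
    moreover have "int l - 1 = int (l - 1)" using 4 by simp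
    ultimately show ?thesis using post[of ?mem'] 4 v tab lt ml rt
      by (simp add: walk_step_prog_def cml del: of_nat_diff)
  qed
qed

lemma wp_walk:
  assumes inp: "inputs mem" and fill: "filled (\<lambda>_ _ _ _. True) mem"
    and post: "\<And>mem' rs cs. optimal rs cs \<Longrightarrow> length rs = m \<Longrightarrow> length cs = n \<Longrightarrow>
      (\<forall>i<m. mem' [i, 14] = int (rs ! i)) \<Longrightarrow> (\<forall>j<n. mem' [j, 16] = int (cs ! j)) \<Longrightarrow>
      (\<forall>j<n. mem' [j, 15] = 0) \<Longrightarrow> P mem' xs ys"
  shows "wp q m n walk_prog P mem xs ys"
proof -
  let ?mem = "mem([0] := int m, [1] := int n, [2] := int n, [3] := 0)"
  have "wp q m n (Loop 7 walk_step_prog) P ?mem xs ys"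
  proof (rule wp_Loop[where I = "\<lambda>t mem' xs' ys'. walk_inv t mem' \<and> xs' = xs \<and> ys' = ys"], goal_cases)
    case 1
    have "walk_inv 0 ?mem"
      unfolding walk_inv_def
      by (rule exI[of _ m], rule exI[of _ n], rule exI[of _ n], rule exI[of _ 0], rule exI[of _ "[]"], rule exI[of _ "[]"])
        (use inp fill in \<open>simp add: inputs_def optimal_def\<close>)
    then show ?case by simp
  next
    case (2 t mem' xs' ys')
    then show ?case using wp_walk_step[of t mem'] by (auto)
  next
    case (3 mem' xs' ys')
    then obtain l r c D rs0 cs0 where le: "l \<le> m" "r \<le> n" "c \<le> n" "D \<le> l * r"
      and zero: "\<forall>j<n. mem' [j, 15] = 0"
      and t: "l + r + c + q \<le> m + n + n \<or> snd (best m f g l r c D) = 0"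
      and rs0: "length rs0 = m - l" "\<forall>i<m - l. mem' [i, 14] = int (rs0 ! i)"
      and cs0: "length cs0 = n - c" "\<forall>j<n - c. mem' [c + j, 16] = int (cs0 ! j)"
      and opt: "\<And>rs cs. completion m l r c D rs cs \<Longrightarrow> cost f g rs cs = fst (best m f g l r c D) \<Longrightarrow>
         optimal (rs0 @ rs) (cs @ cs0)"
      unfolding walk_inv_def by blast
    \<comment> \<open>Every step with a nonzero tag decreases \<open>l + r + c\<close> by one, and
      \<open>q\<close> exceeds the initial value \<open>m + n + n\<close>.\<close>
    have "snd (best m f g l r c D) = 0" using t q_bound by linarith
    from best_choice_0[OF le(4) this] have z: "l = 0" "c = 0" "D = 0" by blast+
    \<comment> \<open>The promise is redeemed with the empty completion.\<close>
    have "optimal (rs0 @ []) ([] @ cs0)"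
      using completion.finish best_finish by (intro opt) (auto simp: z cost_def)
    then show ?case using 3 zero rs0 cs0 z post[of rs0 cs0 mem'] by simp
  qed
  then show ?thesis by (simp add: walk_prog_def)
qed

lemma wp_select:
  assumes count: "mem [6] = int r" "r \<le> n"
    and cl: "\<forall>j<n. mem [j, 16] = int (cl j)" "\<forall>j<n. cl j \<le> m"
    and zero: "\<forall>j<n. mem [j, 15] = 0"
    and post: "\<And>S mem'. S \<subseteq> {..<n} \<Longrightarrow> card S = r \<Longrightarrow>
      (\<And>x y. x \<in> S \<Longrightarrow> y < n \<Longrightarrow> y \<notin> S \<Longrightarrow> cl y \<le> cl x) \<Longrightarrow>
      (\<forall>j<n. mem' [j, 15] = of_bool (j \<in> S)) \<Longrightarrow> mem' [0] = mem [0] \<Longrightarrow>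
      (\<forall>i. mem' [i, 14] = mem [i, 14]) \<Longrightarrow> (\<forall>j. mem' [j, 16] = mem [j, 16]) \<Longrightarrow> P mem' xs ys"
  shows "wp q m n select_prog P mem xs ys"
proof -
  define I where "I = (\<lambda>C mem' xs' ys'. \<exists>S. selection n cl C r S \<and> S \<subseteq> {..<n} \<and>
    mem' [6] = int r - int (card S) \<and> (\<forall>j<n. mem' [j, 15] = of_bool (j \<in> S)) \<and> mem' [0] = mem [0] \<and>
    (\<forall>i. mem' [i, 14] = mem [i, 14]) \<and> (\<forall>j. mem' [j, 16] = mem [j, 16]) \<and> xs' = xs \<and> ys' = ys)"
  \<comment> \<open>The columns considered before sweep \<open>v\<close> reaches column
    \<open>k\<close>: remaining sum above \<open>m - v\<close>, or equal to it with smaller index.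
    The additive form stays correct for \<open>v > m\<close>, where \<open>m - v\<close> would be
    truncated.\<close>
  define C where "C = (\<lambda>v k. {x. x < n \<and> (m < cl x + v \<or> m = cl x + v \<and> x < k)})"
  have C_Suc: "C (Suc v) 0 = C v q" for v
    using n_less_q by (auto simp: C_def)
  show ?thesis
    unfolding select_prog_def
  proof (rule wp_Loop[where I = "\<lambda>v. I (C v 0)"], goal_cases)
    case 1
    have "C 0 0 = {}" using cl(2) by (auto simp: C_def)
    then show ?case
      using assms unfolding I_def by (intro exI[of _ "{}"]) (simp add: selection_def)
  next
    case (3 mem' xs' ys')
    then obtain S where S: "selection n cl (C q 0) r S" "S \<subseteq> {..<n}" "\<forall>j<n. mem' [j, 15] = of_bool (j \<in> S)"
      "mem' [0] = mem [0]" "\<forall>i. mem' [i, 14] = mem [i, 14]" "\<forall>j. mem' [j, 16] = mem [j, 16]" "xs' = xs" "ys' = ys"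
      unfolding I_def by blast
    have "C q 0 = {..<n}" using m_less_q by (auto simp: C_def)
    \<comment> \<open>All \<open>n\<close> columns have been considered, so having chosen fewer than
      \<open>r\<close> would mean having chosen all \<open>n\<close>, against
      \<open>r <= n\<close>.\<close>
    then have "card S = r" using S(1) count(2) by (auto simp: selection_def)
    then have "P mem' xs ys"
      by (intro post[of S] S) (use S(1) in \<open>auto simp: selection_def\<close>)
    then show ?case using S by simp
  next
    case (2 v mem1 xs1 ys1)
    show ?case
    proof (rule wp_Loop[where I = "\<lambda>k mem' xs' ys'. I (C v k) mem' xs' ys' \<and> mem' [7] = int v"], goal_cases)
      case 1
      then show ?case using 2 by (auto simp: I_def)
    next
      case (3 mem' xs' ys')
      then show ?case by (simp add: C_Suc)
    next
      case (2 j mem2 xs2 ys2)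
      then obtain S where S: "selection n cl (C v j) r S" "S \<subseteq> {..<n}" "mem2 [6] = int r - int (card S)"
        "\<forall>j<n. mem2 [j, 15] = of_bool (j \<in> S)"
        "mem2 [0] = mem [0]" "\<forall>i. mem2 [i, 14] = mem [i, 14]" "\<forall>j. mem2 [j, 16] = mem [j, 16]" "xs2 = xs" "ys2 = ys"
        and v: "mem2 [7] = int v" and jq: "j < q"
        unfolding I_def by blast
      let ?mem = "mem2([8] := int j)"
      have CC: "C v j \<subseteq> C v (Suc j)" "C v (Suc j) \<subseteq> insert j (C v j)" by (auto simp: C_def)
      have card: "card S \<le> r" using S(1) by (simp add: selection_def)
      show ?case
      proof (cases "j < n \<and> j \<notin> S \<and> card S < r \<and> m \<le> cl j + v")
        case True
        then have SC: "S = C v j" using S(1) by (auto simp: selection_def)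
        \<comment> \<open>With a larger sum, \<open>j\<close> would have been considered in an
          earlier sweep and would belong to \<open>S = C v j\<close>.\<close>
        have "m = cl j + v" using True SC by (auto simp: C_def)
        then have ins: "insert j (C v j) = C v (Suc j)" using True by (auto simp: C_def)
        have "selection n cl (insert j (C v j)) r (insert j S)"
        proof (rule selection_insert[OF S(1)])
          fix y assume "y < n" "y \<notin> insert j (C v j)"
          then show "cl y \<le> cl j" using \<open>m = cl j + v\<close> by (auto simp: C_def)
        qed (use True in auto)
        then have sel: "selection n cl (C v (Suc j)) r (insert j S)" by (simp add: ins)
        have "card (insert j S) = Suc (card S)"
          using True S(2) finite_subset by (intro card_insert_disjoint) auto
        then have "I (C v (Suc j)) (?mem([j, 15] := 1, [6] := int r - int (card S) - 1)) xs ys"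
          unfolding I_def using S sel True by (intro exI[of _ "insert j S"]) auto
        then show ?thesis using True S v jq cl(1) by (simp)
      next
        case False
        have "selection n cl (C v (Suc j)) r S"
        proof (rule selection_skip[OF S(1) _ CC])
          have "C v (Suc j) = C v j" if "\<not> (j < n \<and> m \<le> cl j + v)"
            using that by (auto simp: C_def less_Suc_eq)
          then show "card S = r \<or> j \<in> S \<or> C v (Suc j) = C v j" using False card by auto
        qed
        then have "I (C v (Suc j)) ?mem xs ys"
          unfolding I_def using S by (intro exI[of _ S]) auto
        then show ?thesis using False S v jq cl(1) card by (auto)
      qed
    qed
  qed
qed

lemma wp_emit:
  assumes cl: "\<forall>j<n. mem [j, 16] = int (cl j)" and S: "\<forall>j<n. mem [j, 15] = of_bool (j \<in> S)"
    and pos: "\<And>j. j \<in> S \<Longrightarrow> 0 < cl j"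
    and post: "\<And>mem'. (\<forall>j<n. mem' [j, 15] = 0) \<Longrightarrow>
      (\<forall>j<n. mem' [j, 16] = int (if j \<in> S then cl j - 1 else cl j)) \<Longrightarrow> mem' [0] = mem [0] \<Longrightarrow>
      (\<forall>i. mem' [i, 14] = mem [i, 14]) \<Longrightarrow> P mem' xs (ys @ map (\<lambda>j. of_bool (j \<in> S)) [0..<n])"
  shows "wp q m n emit_prog P mem xs ys"
  unfolding emit_prog_def
proof (rule wp_Loop[where I = "\<lambda>t mem' xs' ys'.
    (\<forall>j<n. mem' [j, 15] = (if j < t then 0 else of_bool (j \<in> S))) \<and>
    (\<forall>j<n. mem' [j, 16] = int (if j \<in> S \<and> j < t then cl j - 1 else cl j)) \<and> mem' [0] = mem [0] \<and>
    (\<forall>i. mem' [i, 14] = mem [i, 14]) \<and> xs' = xs \<and> ys' = ys @ map (\<lambda>j. of_bool (j \<in> S)) [0..<min t n]"],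
    goal_cases)
  case 1
  then show ?case using cl S by simp
next
  case (2 t mem' xs' ys')
  then show ?case using pos[of t]
    by (auto simp: min_def less_Suc_eq of_nat_diff Suc_leI not_less_eq_eq)
next
  case (3 mem' xs' ys')
  then show ?case using post[of mem'] n_less_q by simp
qed

lemma wp_matrix:
  assumes gr: "gale_ryser n rs (\<lambda>j. cs ! j)" and len: "length rs = m" "length cs = n"
    and le: "\<forall>x\<in>set rs. x \<le> n" "\<forall>x\<in>set cs. x \<le> m"
    and rows: "\<forall>i<m. mem [i, 14] = int (rs ! i)" and cols: "\<forall>j<n. mem [j, 16] = int (cs ! j)"
    and zero: "\<forall>j<n. mem [j, 15] = 0"
    and post: "\<And>mem' A. A \<in> binary_mats m n \<Longrightarrow> (\<forall>i<m. row_sum A i = rs ! i) \<Longrightarrow>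
      (\<forall>j<n. col_sum A j = cs ! j) \<Longrightarrow> P mem' xs (ys @ encode_mat A)"
  shows "wp q m n matrix_prog P mem xs ys"
proof -
  define out where "out = (\<lambda>T i. concat (map (\<lambda>i. map (\<lambda>j. of_bool (j \<in> T i) :: int) [0..<n]) [0..<i]))"
  have out_Suc: "out T (Suc i) = out T i @ map (\<lambda>j. of_bool (j \<in> T i)) [0..<n]" for T i
    by (simp add: out_def)
  have out_cong: "out T i = out T' i" if "\<And>k. k < i \<Longrightarrow> T k = T' k" for T T' i
    unfolding out_def using that by (intro arg_cong[of _ _ concat] map_cong) auto
  \<comment> \<open>\<open>cl\<close> are the remaining column sums and \<open>T i\<close> the
    columns with a one in row \<open>i\<close>; rounds from \<open>m\<close> on are idle, hence
    \<open>min t m\<close>.\<close>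
  define I where "I = (\<lambda>t mem' xs' ys'. \<exists>T cl. gale_ryser n (drop t rs) cl \<and> (\<forall>j<n. cl j \<le> m) \<and>
    (\<forall>j<n. mem' [j, 16] = int (cl j)) \<and> (\<forall>j<n. mem' [j, 15] = 0) \<and>
    (\<forall>i<m. mem' [i, 14] = int (rs ! i)) \<and> (\<forall>i<min t m. T i \<subseteq> {..<n} \<and> card (T i) = rs ! i) \<and>
    (\<forall>j<n. cl j + (\<Sum>i<min t m. of_bool (j \<in> T i)) = cs ! j) \<and> xs' = xs \<and> ys' = ys @ out T (min t m))"
  show ?thesis
    unfolding matrix_prog_def
  proof (rule wp_Loop[where I = I], goal_cases)
    case 1
    show ?case unfolding I_def
      by (rule exI[of _ "\<lambda>_. {}"], rule exI[of _ "\<lambda>j. cs ! j"])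
        (use gr len le rows cols zero in \<open>auto simp: out_def\<close>)
  next
    case (2 t mem1 xs1 ys1)
    then obtain T cl where T: "gale_ryser n (drop t rs) cl" "\<forall>j<n. cl j \<le> m"
      "\<forall>j<n. mem1 [j, 16] = int (cl j)" "\<forall>j<n. mem1 [j, 15] = 0"
      "\<forall>i<m. mem1 [i, 14] = int (rs ! i)" "\<forall>i<min t m. T i \<subseteq> {..<n} \<and> card (T i) = rs ! i"
      "\<forall>j<n. cl j + (\<Sum>i<min t m. of_bool (j \<in> T i)) = cs ! j" "xs1 = xs" "ys1 = ys @ out T (min t m)"
      unfolding I_def by blast
    show ?case
    proof (cases "t < m")
      case False
      then have "drop (Suc t) rs = drop t rs" "min (Suc t) m = min t m" using len by auto
      then have "I (Suc t) (mem1([0] := int t)) xs ys1"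
        unfolding I_def using T by (intro exI[of _ T] exI[of _ cl]) simp
      then show ?thesis using False T(8) by (simp)
    next
      case True
      have dr: "drop t rs = rs ! t # drop (Suc t) rs" using True len by (simp add: Cons_nth_drop_Suc)
      have rt: "rs ! t \<le> n" using le(1) True len by simp
      let ?mem = "mem1([0] := int t, [6] := int (rs ! t))"
      have "wp q m n (select_prog ;; emit_prog) (I (Suc t)) ?mem xs1 ys1"
        unfolding wp.simps
      proof (rule wp_select[where r = "rs ! t" and cl = cl], goal_cases)
        case (6 S mem2)
        have gr_t: "gale_ryser n (rs ! t # drop (Suc t) rs) cl" using T(1) dr by simp
        have greedy: "gale_ryser n (drop (Suc t) rs) (\<lambda>j. if j \<in> S then cl j - 1 else cl j)"
          "\<And>x. x \<in> S \<Longrightarrow> 0 < cl x"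
          using gale_ryser_greedy[OF gr_t 6(1,2)] 6(3) by blast+
        show ?case
        proof (rule wp_emit[where cl = cl and S = S], goal_cases)
          case (4 mem3)
          let ?T = "T(t := S)"
          have cs: "0 < cs ! j" if "j \<in> S" "j < n" for j
            using T(7) greedy(2)[OF that(1)] that(2) by (metis add_gr_0)
          have "out ?T t = out T t" by (rule out_cong) simp
          moreover have "(\<Sum>i<t. of_bool (j \<in> ?T i)) = (\<Sum>i<t. of_bool (j \<in> T i) :: nat)" for j
            by (intro sum.cong) auto
          ultimately show ?case
            unfolding I_def using True T greedy 4 6
            by (intro exI[of _ ?T] exI[of _ "\<lambda>j. if j \<in> S then cl j - 1 else cl j"])
              (auto simp: min_absorb1 Suc_leI out_Suc less_Suc_eq cs)
        qed (use 6 greedy T in auto)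
      qed (use T rt in auto)
      moreover have "t < q" using True m_less_q by simp
      ultimately show ?thesis using True T by (simp)
    qed
  next
    case (3 mem' xs' ys')
    have mq: "min q m = m" using m_less_q by simp
    have "drop q rs = []" using m_less_q len by simp
    then obtain T cl where T: "gale_ryser n [] cl"
      "\<forall>i<m. T i \<subseteq> {..<n} \<and> card (T i) = rs ! i"
      "\<forall>j<n. cl j + (\<Sum>i<m. of_bool (j \<in> T i)) = cs ! j" "xs' = xs" "ys' = ys @ out T m"
      using 3 unfolding I_def mq by auto
    define A :: "nat mat" where "A = mat m n (\<lambda>(i, j). of_bool (j \<in> T i))"
    have "A \<in> binary_mats m n" by (auto simp: binary_mats_def A_def)
    moreover have "row_sum A i = rs ! i" if "i < m" for i
    proof -
      have "row_sum A i = (\<Sum>j<n. of_bool (j \<in> T i))" using that by (simp add: row_sum_def A_def)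
      also have "\<dots> = card (T i)" using T(2) that by (simp add: Int_absorb1)
      finally show ?thesis using T(2) that by simp
    qed
    \<comment> \<open>With no row left, \<open>gale_ryser\<close> forces the remaining column sums
      to be zero, so the ones placed account for all of \<open>cs\<close>.\<close>
    moreover have "col_sum A j = cs ! j" if "j < n" for j
      using that T(3)[rule_format, OF that] gale_ryser_Nil[OF T(1) that] by (simp add: col_sum_def A_def)
    moreover have "encode_mat A = out T m"
      unfolding encode_mat_def out_def
      by (intro arg_cong[of _ _ concat] map_cong) (auto simp: A_def)
    ultimately show ?case using post[of A] T(4,5) by simp
  qed
qed

text \<open>The matrix written attains \<open>best\<close> at the initial state, and by
  \<open>binary_mats_completion\<close> and \<open>best_le_cost\<close> no matrix has a smaller
  objective.\<close>

lemma wp_line_sum: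
  "wp q m n line_sum_prog (\<lambda>_ _ ys. \<exists>A. is_arg_min (uniform_objective f g) (\<lambda>B. B \<in> binary_mats m n) A \<and>
     ys = encode_mat A) (\<lambda>_. 0) (map f [0..<n + 1] @ map g [0..<m + 1]) []"
  (is "wp q m n _ ?P _ _ _")
proof -
  have "wp q m n (read_array 11 BndM ;; tables_prog ;; walk_prog ;; matrix_prog) ?P mem1 (map g [0..<m + 1] @ []) []"
    if mem1: "\<forall>i\<le>n. mem1 [i, nat 10] = f i" "\<forall>k. k \<noteq> [0] \<longrightarrow> (\<forall>i. k \<noteq> [i, nat 10]) \<longrightarrow> mem1 k = 0" for mem1
    unfolding wp.simps
  proof (rule wp_read_array[where N = m], goal_cases)
    case (5 mem2)
    have "inputs mem2" using mem1 5 by (simp add: inputs_def)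
    then show ?case
    proof (rule wp_tables, goal_cases)
      case (1 mem3)
      then show ?case
      proof (rule wp_walk, goal_cases)
        case (1 mem4 rs cs)
        then have comp: "completion m m n n 0 rs cs" and opt: "cost f g rs cs = fst (best m f g m n n 0)"
          by (auto simp: optimal_def)
        show ?case
        proof (rule wp_matrix[OF completion_gale_ryser(1)[OF comp] completion_gale_ryser(2)[OF comp]
              completion_gale_ryser(3)[OF comp] completion_gale_ryser(4)[OF comp]
              completion_gale_ryser(5)[OF comp]], goal_cases)
          case (4 mem5 A)
          have dim: "dim_row A = m" "dim_col A = n" using 4 by (auto simp: binary_mats_def)
          have "uniform_objective f g A = (\<Sum>i<m. f (rs ! i)) + (\<Sum>j<n. g (cs ! j))"
            using 4 by (simp add: uniform_objective_def dim)
          also have "\<dots> = cost f g rs cs"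
            using 1 by (simp add: cost_def sum_list_sum_nth atLeast0LessThan)
          finally have obj: "uniform_objective f g A = fst (best m f g m n n 0)" using opt by simp
          have "uniform_objective f g A \<le> uniform_objective f g B" if B: "B \<in> binary_mats m n" for B
          proof -
            obtain rs' cs' where "completion m m n n 0 rs' cs'"
              "uniform_objective f g B = sum_list (map f rs') + sum_list (map g cs')"
              using binary_mats_completion[OF B] by blast
            then show ?thesis using best_le_cost[of m m n n 0 rs' cs' f g] obj by (simp add: cost_def)
          qed
          then have "is_arg_min (uniform_objective f g) (\<lambda>B. B \<in> binary_mats m n) A"
            using 4 by (auto simp: is_arg_min_linorder)
          then show ?case by auto
        qed (use 1 in auto)
      qed
    qed
  qed (use m_less_q in auto)
  then have *: "wp q m n (read_array 10 BndN) (wp q m n (read_array 11 BndM ;; tables_prog ;; walk_prog ;; matrix_prog) ?P)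
      (\<lambda>_. 0) (map f [0..<n + 1] @ map g [0..<m + 1]) []"
    using n_less_q by (intro wp_read_array[where N = n]) auto
  then show ?thesis by (simp only: line_sum_prog_def wp.simps)
qed

end

end

theorem theorem1p1:
  "\<exists>(P :: ram) (p :: nat poly).
     \<forall>(m :: nat) (n :: nat) (f :: nat \<Rightarrow> int) (g :: nat \<Rightarrow> int). m \<ge> 1 \<longrightarrow> n \<ge> 1 \<longrightarrow>
       (\<exists>A t. is_arg_min (uniform_objective f g) (\<lambda>B. B \<in> binary_mats m n) A \<and>
              halts_with P (encode_instance m n f g) (encode_mat A) t \<and>
              t \<le> poly p (input_length (encode_instance m n f g)))"
proof -
  define K where "K = 16 + depth line_sum_prog"
  obtain P p where Pp: "\<And>m n xs Q. m \<le> length xs \<Longrightarrow> n \<le> length xs \<Longrightarrow>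
    wp ((m + K) * (n + K)) m n line_sum_prog (\<lambda>_ _ ys. Q ys) (\<lambda>_. 0) xs [] \<Longrightarrow>
    \<exists>ys t. Q ys \<and> halts_with P (int m # int n # xs) ys t \<and>
      t \<le> poly p (input_length (int m # int n # xs))"
    using prog_polytime[of line_sum_prog] unfolding K_def by blast
  show ?thesis
  proof (intro exI[of _ P] exI[of _ p] allI impI)
    fix m n :: nat and f g :: "nat \<Rightarrow> int"
    let ?xs = "map f [0..<n + 1] @ map g [0..<m + 1]"
    have "(m + 16) * (n + 16) \<le> (m + K) * (n + K)" by (intro mult_le_mono) (auto simp: K_def)
    note wp = wp_line_sum[OF this, of f g]
    have "encode_instance m n f g = int m # int n # ?xs" by (simp add: encode_instance_def)
    \<comment> \<open>The list \<open>?xs\<close> has \<open>n + m + 2\<close> entries, so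
      \<open>m\<close> and \<open>n\<close> are at most its length.\<close>
    with Pp[OF _ _ wp]
    show "\<exists>A t. is_arg_min (uniform_objective f g) (\<lambda>B. B \<in> binary_mats m n) A \<and>
              halts_with P (encode_instance m n f g) (encode_mat A) t \<and>
              t \<le> poly p (input_length (encode_instance m n f g))"
      by (auto simp del: upt_Suc)
  qed
qed

end
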